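(* Let $V$ be a finite-dimensional complex vector space. The Comon conjecture holds for every $T\in\hat\sigma_3(v_3(\mathbb P V))\subset S^3V$; that is, for every such $T$ the symmetric tensor rank of $T$ equals the tensor rank of $T$ regarded as an element of $V\otimes V\otimes V$.
   Context: $v_3(\mathbb P V)=\{[x^3]: x\in V\setminus 0\}\subset\mathbb P(S^3V)$ is the cubic Veronese variety. $\sigma_3(X)$ is the third secant variety: the set of points $p$ for which there are curves $x_1(t),x_2(t),x_3(t)\in X$ with $p$ in the limiting plane $\lim_{t\to0}\langle x_1(t),x_2(t),x_3(t)\rangle$; $\hat\sigma_3(X)$ is the affine cone over it. The symmetric tensor rank of $T\in S^3V$ is the smallest $r$ such that $T$ is a linear combination of $r$ cubes $x_1^3,\dots,x_r^3$, $x_i\in V$. The tensor rank of $T\in V\otimes V\otimes V$ is the smallest $r$ such that $T$ is a sum of $r$ decomposable tensors $u\otimes v\otimes w$. One views $S^3V\subset V^{\otimes3}$ as the symmetric tensors. *)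

theory Defs
  imports "HOL-Analysis.Analysis"
begin

text \<open>
  A finite-dimensional complex vector space \<open>V\<close> is \<open>complex ^ 'n\<close>, and \<open>V \<otimes> V \<otimes> V\<close> is the
  coordinate space \<open>complex ^ ('n \<times> 'n \<times> 'n)\<close>. The symmetric tensors \<open>S\<^sup>3 V\<close> sit inside it,
  with \<open>x\<^sup>3\<close> corresponding to \<open>x \<otimes> x \<otimes> x\<close>.
\<close>

definition tensor3 ::
  "complex ^ 'n \<Rightarrow> complex ^ 'n \<Rightarrow> complex ^ 'n \<Rightarrow> complex ^ ('n::finite \<times> 'n \<times> 'n)"
  where "tensor3 u v w = (\<chi> p. case p of (i, j, k) \<Rightarrow> u $ i * v $ j * w $ k)"

definition cube :: "complex ^ 'n \<Rightarrow> complex ^ ('n::finite \<times> 'n \<times> 'n)"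
  where "cube x = tensor3 x x x"

definition tensor_rank :: "complex ^ ('n::finite \<times> 'n \<times> 'n) \<Rightarrow> nat"
  where "tensor_rank T =
    (LEAST r. \<exists>u v w :: nat \<Rightarrow> complex ^ 'n. T = (\<Sum>i<r. tensor3 (u i) (v i) (w i)))"

text \<open>Only meaningful for symmetric tensors, which are exactly the linear combinations of cubes.\<close>

definition symmetric_rank :: "complex ^ ('n::finite \<times> 'n \<times> 'n) \<Rightarrow> nat"
  where "symmetric_rank T =
    (LEAST r. \<exists>(c :: nat \<Rightarrow> complex) (x :: nat \<Rightarrow> complex ^ 'n). T = (\<Sum>i<r. c i *s cube (x i)))"

text \<open>
  A projective variety is represented by its affine cone without the origin, that is, by the set
  of all vectors representing its points.
\<close>

definition veronese_cone :: "(complex ^ ('n::finite \<times> 'n \<times> 'n)) set"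
  where "veronese_cone = {c *s cube x | c x. c \<noteq> 0 \<and> x \<noteq> 0}"

definition frame_of :: "nat \<Rightarrow> (nat \<Rightarrow> complex ^ 'm) \<Rightarrow> (complex ^ 'm::finite) set \<Rightarrow> bool"
  where "frame_of k b E \<longleftrightarrow>
    inj_on b {..<k} \<and> vec.independent (b ` {..<k}) \<and> vec.span (b ` {..<k}) = E"

text \<open>
  Convergence in the Grassmannian of \<open>k\<close>-dimensional subspaces, which carries the quotient topology
  of the space of \<open>k\<close>-frames: subspaces converge iff they have bases converging to a basis of
  the limit.
\<close>

definition subspace_tendsto ::
  "('a \<Rightarrow> (complex ^ 'm::finite) set) \<Rightarrow> (complex ^ 'm) set \<Rightarrow> 'a filter \<Rightarrow> bool"
  where "subspace_tendsto E L F \<longleftrightarrow>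
    (\<exists>k e b. (\<forall>\<^sub>F t in F. frame_of k (\<lambda>i. e i t) (E t)) \<and> frame_of k b L \<and>
      (\<forall>i<k. ((\<lambda>t. e i t) \<longlongrightarrow> b i) F))"

text \<open>
  The affine cone (with origin) over the third secant variety of \<open>X\<close>. Curves are continuous
  and given by continuous lifts to the cone; as they are only evaluated for \<open>t > 0\<close>, neither
  smoothness nor convergence of the points at \<open>t = 0\<close> is required, only that of their span.
  The span may have dimension less than three, so that small ambient spaces and coinciding points
  are not excluded.
\<close>

definition secant3_cone :: "(complex ^ 'm::finite) set \<Rightarrow> (complex ^ 'm) set"
  where "secant3_cone X = insert 0
    {p. \<exists>(x1 :: real \<Rightarrow> complex ^ 'm) x2 x3 L.
      (\<forall>x \<in> {x1, x2, x3}. continuous_on {0<..1} x \<and> x ` {0<..1} \<subseteq> X) \<and>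
      subspace_tendsto (\<lambda>t. vec.span {x1 t, x2 t, x3 t}) L (at_right 0) \<and> p \<in> L}"

end

(* A tensor in the closure of the sums of three cubes satisfies closed conditions: it is symmetric,
   the Aronhold invariant of any three vectors vanishes, and any four vectors are dependent modulo
   the radical. By the last condition it is pulled back from a cubic in three variables. For such a
   cubic the slices contain a singular one, so there are nonzero a, k with tau(a, k, .) = 0; in a
   basis adapted to a and k the vanishing of the Aronhold invariant leaves only the normal forms
   p f^3 + q g^3 + r h^3, f^2 g + p h^3 and f^2 h + f g^2. For each of these an explicit sum of cubes
   has as many terms as the lower bound that the substitution method gives for the tensor rank. *)
theory Submission
  imports Defs "HOL-Computational_Algebra.Fundamental_Theorem_Algebra"
begin

section \<open>Linear forms and the substitution method\<close>

text \<open>Tensors are handled as trilinear forms, because decompositions of forms pull back along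
  arbitrary linear maps and the number of variables has to drop to three. The Aronhold invariant is
  imposed on all triples of vectors at once, so its vanishing does not depend on coordinates and
  survives every pullback. The determinant of the slice at \<open>a\<close> is, up to a scalar, the
  Hessian of the cubic at \<open>a\<close>: a singular slice is a point of the Hessian curve. In a
  basis \<open>a\<close>, \<open>k\<close>, \<open>m\<close> the relation
  \<open>\<tau> a k z = 0\<close> removes every monomial containing both of the first two
  coordinates. The cubic becomes a binary cubic in \<open>f\<close>, \<open>h\<close> plus one in
  \<open>g\<close>, \<open>h\<close>, and the invariant collapses to a product that tells which
  piece degenerates. The normal forms can have rank 4 or 5, while the flattening of a form in three
  variables has rank at most 3; this gap is what the substitution method has to close.\<close>

definition linform :: "(complex ^ 'n \<Rightarrow> complex) \<Rightarrow> bool"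
  where "linform f \<longleftrightarrow> (\<forall>x y. f (x + y) = f x + f y) \<and> (\<forall>c x. f (c *s x) = c * f x)"

lemma linform_add: "linform f \<Longrightarrow> f (x + y) = f x + f y"
  and linform_scale: "linform f \<Longrightarrow> f (c *s x) = c * f x"
  by (auto simp: linform_def)

lemma linform_0: "linform f \<Longrightarrow> f 0 = 0"
  using linform_scale[of f 0 0] by simp

lemma linform_diff: "linform f \<Longrightarrow> f (x - y) = f x - f y"
  using linform_add[of f x "(-1) *s y"] linform_scale[of f "-1" y]
  by (simp add: vector_sneg_minus1[symmetric])

lemma linform_sum: "linform f \<Longrightarrow> f (\<Sum>j\<in>J. g j) = (\<Sum>j\<in>J. f (g j))"
  by (induction J rule: infinite_finite_induct) (auto simp: linform_0 linform_add)

lemmas linform_simps = linform_0 linform_add linform_diff linform_scale linform_sum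

lemma linform_add_fun: "linform f \<Longrightarrow> linform g \<Longrightarrow> linform (\<lambda>x. f x + g x)"
  and linform_scale_fun: "linform f \<Longrightarrow> linform (\<lambda>x. c * f x)"
  and linform_diff_fun: "linform f \<Longrightarrow> linform g \<Longrightarrow> linform (\<lambda>x. f x - g x)"
  by (auto simp: linform_def algebra_simps)

text \<open>Each vector of the system \<open>n\<close> is used up to make one more of the forms \<open>u i\<close> vanish.\<close>

lemma shift_into_kernels:
  fixes u :: "'i \<Rightarrow> complex ^ 'n \<Rightarrow> complex"
  assumes "finite J" "finite I" "\<And>i. linform (u i)"
    and "\<And>c. \<exists>j\<in>J. c j \<noteq> 0 \<Longrightarrow> \<exists>i\<in>I. u i (\<Sum>j\<in>J. c j *s n j) \<noteq> 0"
  shows "\<exists>c. card {i \<in> I. u i (x + (\<Sum>j\<in>J. c j *s n j)) \<noteq> 0} + card J \<le> card I"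
  using assms(1,2,4)
proof (induction J arbitrary: I n x rule: finite_induct)
  case empty
  then show ?case by (auto intro: card_mono)
next
  case (insert k J)
  have "\<exists>i\<in>I. u i (\<Sum>j\<in>insert k J. (if j = k then 1 else 0) *s n j) \<noteq> 0"
    by (rule insert.prems(2)) auto
  moreover have "(\<Sum>j\<in>insert k J. (if j = k then 1 else 0) *s n j) = n k"
    using insert.hyps by (simp add: if_distrib[of "\<lambda>c. c *s _"] sum.delta cong: if_cong)
  ultimately obtain i0 where i0: "i0 \<in> I" "u i0 (n k) \<noteq> 0" by auto
  \<comment> \<open>\<open>p\<close> projects onto the kernel of \<open>u i0\<close> along
    \<open>n k\<close>. Recursing on projected vectors keeps \<open>u i0\<close> at zero, so that
    \<open>i0\<close> can be struck from \<open>I\<close>.\<close>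
  define p where "p y = y - (u i0 y / u i0 (n k)) *s n k" for y
  have up: "u i0 (p y) = 0" for y
    using i0 by (simp add: p_def linform_simps assms(3))
  have psum: "p (y + (\<Sum>j\<in>J. c j *s n j)) = p y + (\<Sum>j\<in>J. c j *s p (n j))" for c y
    by (simp add: p_def linform_simps assms(3) sum_subtractf vector_ssub_ldistrib
      vector_smult_assoc add_divide_distrib vector_sadd_rdistrib vec.scale_sum_left sum_divide_distrib)
  have p0: "p 0 = 0" by (simp add: p_def linform_simps assms(3))
  \<comment> \<open>Projecting does not leave the allowed shifts: all corrections are multiples of
    \<open>n k\<close> and go into its coefficient.\<close>
  have ins: "p (y + (\<Sum>j\<in>J. c j *s n j))
      = y + (\<Sum>j\<in>insert k J. (c(k := - u i0 (y + (\<Sum>j\<in>J. c j *s n j)) / u i0 (n k))) j *s n j)" for c y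
  proof -
    have "(\<Sum>j\<in>J. (c(k := b)) j *s n j) = (\<Sum>j\<in>J. c j *s n j)" for b
      using insert.hyps by (intro sum.cong) auto
    then show ?thesis
      using insert.hyps by (simp add: p_def vec.scale_minus_left)
  qed
  have "\<exists>i\<in>I - {i0}. u i (\<Sum>j\<in>J. c j *s p (n j)) \<noteq> 0" if "\<exists>j\<in>J. c j \<noteq> 0" for c
  proof -
    let ?b = "c(k := - u i0 (0 + (\<Sum>j\<in>J. c j *s n j)) / u i0 (n k))"
    have "\<exists>j\<in>insert k J. ?b j \<noteq> 0" using that insert.hyps by auto
    from insert.prems(2)[OF this] obtain i where i: "i \<in> I" "u i (\<Sum>j\<in>insert k J. ?b j *s n j) \<noteq> 0"
      by blast
    have eq: "(\<Sum>j\<in>insert k J. ?b j *s n j) = (\<Sum>j\<in>J. c j *s p (n j))"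
      using ins[of 0 c] psum[of 0 c] p0 by simp
    have "u i0 (\<Sum>j\<in>J. c j *s p (n j)) = 0"
      by (simp add: linform_simps assms(3) up)
    then show ?thesis using i eq by (auto intro!: bexI[of _ i])
  qed
  from insert.IH[of "I - {i0}" "\<lambda>j. p (n j)" "p x", OF _ this] insert.prems(1)
  obtain c where c: "card {i \<in> I - {i0}. u i (p x + (\<Sum>j\<in>J. c j *s p (n j))) \<noteq> 0} + card J \<le> card (I - {i0})"
    by auto
  let ?y = "p x + (\<Sum>j\<in>J. c j *s p (n j))"
  have "u i0 ?y = 0" by (simp add: linform_simps assms(3) up)
  then have "{i \<in> I. u i ?y \<noteq> 0} = {i \<in> I - {i0}. u i ?y \<noteq> 0}" by auto
  moreover have "card (I - {i0}) + 1 = card I"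
    using i0(1) insert.prems(1) by (metis card.remove Suc_eq_plus1)
  moreover define b where "b = c(k := - u i0 (x + (\<Sum>j\<in>J. c j *s n j)) / u i0 (n k))"
  have "?y = x + (\<Sum>j\<in>insert k J. b j *s n j)"
    unfolding b_def using ins[of x c] psum[of x c] by simp
  ultimately have "card {i \<in> I. u i (x + (\<Sum>j\<in>insert k J. b j *s n j)) \<noteq> 0} + card (insert k J) \<le> card I"
    using c insert.hyps by simp
  then show ?case by blast
qed

text \<open>The substitution method. Taking \<open>J = {}\<close> gives the bound by the rank of a slice, taking
  \<open>K = {}\<close> the bound by the rank of the flattening.\<close>

lemma substitution_bound:
  fixes \<tau> :: "complex ^ 'n \<Rightarrow> complex ^ 'n \<Rightarrow> complex ^ 'n \<Rightarrow> complex" and r :: nat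
  assumes lin: "\<And>i. linform (u i)" "\<And>i. linform (v i)"
    and dec: "\<And>x y z. \<tau> x y z = (\<Sum>i<r. u i x * v i y * w i z)"
    and "finite J" "finite K"
    and N: "\<And>c. \<exists>j\<in>J. c j \<noteq> 0 \<Longrightarrow> \<exists>y z. \<tau> (\<Sum>j\<in>J. c j *s n j) y z \<noteq> 0"
    and E: "\<And>s c. \<exists>j\<in>K. c j \<noteq> 0 \<Longrightarrow>
      \<exists>z. \<tau> (x + (\<Sum>j\<in>J. s j *s n j)) (\<Sum>j\<in>K. c j *s e j) z \<noteq> 0"
  shows "card J + card K \<le> r"
proof -
  have "\<exists>i\<in>{..<r}. u i (\<Sum>j\<in>J. c j *s n j) \<noteq> 0" if c: "\<exists>j\<in>J. c j \<noteq> 0" for c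
    using N[OF c] unfolding dec by (metis (no_types, lifting) mult_zero_left sum.neutral)
  from shift_into_kernels[where I = "{..<r}" and u = u and x = x and n = n, OF \<open>finite J\<close> _ lin(1) this]
  obtain s where s: "card {i \<in> {..<r}. u i (x + (\<Sum>j\<in>J. s j *s n j)) \<noteq> 0} + card J \<le> r" by auto
  \<comment> \<open>The terms that survive in the shifted slice, at most \<open>r - card J\<close>
    in number.\<close>
  define I where "I = {i \<in> {..<r}. u i (x + (\<Sum>j\<in>J. s j *s n j)) \<noteq> 0}"
  have "\<exists>i\<in>I. v i (\<Sum>j\<in>K. c j *s e j) \<noteq> 0" if c: "\<exists>j\<in>K. c j \<noteq> 0" for c
  proof -
    obtain z where "\<tau> (x + (\<Sum>j\<in>J. s j *s n j)) (\<Sum>j\<in>K. c j *s e j) z \<noteq> 0" using E[OF c] by blast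
    then obtain i where "i < r" "u i (x + (\<Sum>j\<in>J. s j *s n j)) * v i (\<Sum>j\<in>K. c j *s e j) * w i z \<noteq> 0"
      unfolding dec by (metis (no_types, lifting) sum.neutral lessThan_iff)
    then show ?thesis by (auto simp: I_def)
  qed
  \<comment> \<open>Now the same lemma serves as plain linear algebra: forms without a common zero
    on the span of \<open>card K\<close> independent vectors number at least
    \<open>card K\<close>.\<close>
  from shift_into_kernels[where I = I and u = v and x = 0 and n = e, OF \<open>finite K\<close> _ lin(2) this]
  have "card K \<le> card I" by (auto simp: I_def)
  with s show ?thesis by (simp add: I_def)
qed

section \<open>Normal forms\<close>

definition cub :: "('a \<Rightarrow> complex) \<Rightarrow> 'a \<Rightarrow> 'a \<Rightarrow> 'a \<Rightarrow> complex"
  where "cub f x y z = f x * f y * f z"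

text \<open>The polarization of \<open>3 f\<^sup>2 g\<close>.\<close>

definition sqr :: "('a \<Rightarrow> complex) \<Rightarrow> ('a \<Rightarrow> complex) \<Rightarrow> 'a \<Rightarrow> 'a \<Rightarrow> 'a \<Rightarrow> complex"
  where "sqr f g x y z = f x * f y * g z + f x * g y * f z + g x * f y * f z"

text \<open>Linearity is asked of the whole family, also beyond index \<open>r\<close>, which spares
  side conditions; finite lists of forms are therefore extended by a default index later on.\<close>

definition cubes_sum :: "nat \<Rightarrow> (complex ^ 'n \<Rightarrow> complex ^ 'n \<Rightarrow> complex ^ 'n \<Rightarrow> complex) \<Rightarrow> bool"
  where "cubes_sum r \<tau> \<longleftrightarrow>
    (\<exists>c f. (\<forall>i. linform (f i)) \<and> (\<forall>x y z. \<tau> x y z = (\<Sum>i<r. c i * cub (f i) x y z)))"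

definition products_sum :: "nat \<Rightarrow> (complex ^ 'n \<Rightarrow> complex ^ 'n \<Rightarrow> complex ^ 'n \<Rightarrow> complex) \<Rightarrow> bool"
  where "products_sum r \<tau> \<longleftrightarrow>
    (\<exists>u v w. (\<forall>i. linform (u i)) \<and> (\<forall>i. linform (v i)) \<and> (\<forall>i. linform (w i)) \<and>
      (\<forall>x y z. \<tau> x y z = (\<Sum>i<r. u i x * v i y * w i z)))"

text \<open>This form of the Comon property, unlike the equality of two \<open>LEAST\<close> numbers, is transported
  by linear substitutions.\<close>

definition comon :: "(complex ^ 'n \<Rightarrow> complex ^ 'n \<Rightarrow> complex ^ 'n \<Rightarrow> complex) \<Rightarrow> bool"
  where "comon \<tau> \<longleftrightarrow> (\<exists>r. cubes_sum r \<tau> \<and> (\<forall>s. products_sum s \<tau> \<longrightarrow> r \<le> s))"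

lemma comonI:
  fixes c :: "nat \<Rightarrow> complex"
  assumes lin: "\<And>i. linform (f i)" and dec: "\<And>x y z. \<tau> x y z = (\<Sum>i<r. c i * cub (f i) x y z)"
    and least: "\<And>s u v w. (\<And>i. linform (u i)) \<Longrightarrow> (\<And>i. linform (v i)) \<Longrightarrow>
      (\<And>x y z. \<tau> x y z = (\<Sum>i<s. u i x * v i y * w i z)) \<Longrightarrow> r \<le> s"
  shows "comon \<tau>"
proof -
  have "cubes_sum r \<tau>"
    unfolding cubes_sum_def using lin dec by (intro exI[of _ c] exI[of _ f] conjI allI)
  moreover have "r \<le> s" if "products_sum s \<tau>" for s
  proof -
    from that obtain u v w where u: "\<forall>i. linform (u i)" and v: "\<forall>i. linform (v i)"
      and eq: "\<forall>x y z. \<tau> x y z = (\<Sum>i<s. u i x * v i y * w i z)"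
      unfolding products_sum_def by (elim exE conjE) (rule that)
    show ?thesis by (rule least[OF u[rule_format] v[rule_format] eq[rule_format]])
  qed
  ultimately show ?thesis unfolding comon_def by blast
qed

section \<open>Transport of decompositions along linear maps\<close>

definition linmap :: "(complex ^ 'n \<Rightarrow> complex ^ 'm) \<Rightarrow> bool"
  where "linmap h \<longleftrightarrow> (\<forall>x y. h (x + y) = h x + h y) \<and> (\<forall>c x. h (c *s x) = c *s h x)"

lemma linform_comp: "linform f \<Longrightarrow> linmap h \<Longrightarrow> linform (\<lambda>x. f (h x))"
  by (simp add: linform_def linmap_def)

lemma cubes_sum_pullback:
  assumes "linmap g" "cubes_sum r \<sigma>"
  shows "cubes_sum r (\<lambda>x y z. \<sigma> (g x) (g y) (g z))"
proof -
  from assms(2) obtain c f where lin: "\<forall>i. linform (f i)"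
    and dec: "\<forall>x y z. \<sigma> x y z = (\<Sum>i<r. c i * cub (f i) x y z)"
    unfolding cubes_sum_def by (elim exE conjE) (rule that)
  show ?thesis
    unfolding cubes_sum_def
  proof (intro exI[of _ c] exI[of _ "\<lambda>i x. f i (g x)"] conjI allI)
    show "linform (\<lambda>x. f i (g x))" for i using lin assms(1) by (simp add: linform_comp)
    show "\<sigma> (g x) (g y) (g z) = (\<Sum>i<r. c i * cub (\<lambda>x. f i (g x)) x y z)" for x y z
      by (simp add: dec cub_def)
  qed
qed

lemma products_sum_pullback:
  assumes "linmap g" "products_sum r \<sigma>"
  shows "products_sum r (\<lambda>x y z. \<sigma> (g x) (g y) (g z))"
proof -
  from assms(2) obtain u v w where lin: "\<forall>i. linform (u i)" "\<forall>i. linform (v i)" "\<forall>i. linform (w i)"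
    and dec: "\<forall>x y z. \<sigma> x y z = (\<Sum>i<r. u i x * v i y * w i z)"
    unfolding products_sum_def by (elim exE conjE) (rule that)
  show ?thesis
    unfolding products_sum_def
    apply (rule exI[of _ "\<lambda>i x. u i (g x)"], rule exI[of _ "\<lambda>i x. v i (g x)"], rule exI[of _ "\<lambda>i x. w i (g x)"])
    using lin assms(1) by (simp add: dec linform_comp)
qed

text \<open>Each form is a pullback of the other: cubes for \<sigma> move to \<tau> along
  \<open>g\<close>, and products for \<tau> move to \<sigma> along \<open>h\<close>, so that the
  lower bound survives. The maps need not be mutually inverse, which allows trading \<open>n\<close>
  variables for three.\<close>

lemma comon_pullback:
  assumes "linmap g" "linmap h" "comon \<sigma>"
    and \<tau>: "\<tau> = (\<lambda>x y z. \<sigma> (g x) (g y) (g z))" and \<sigma>: "\<sigma> = (\<lambda>x y z. \<tau> (h x) (h y) (h z))"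
  shows "comon \<tau>"
proof -
  from \<open>comon \<sigma>\<close> obtain r where r: "cubes_sum r \<sigma>" "\<And>s. products_sum s \<sigma> \<Longrightarrow> r \<le> s"
    unfolding comon_def by blast
  have "cubes_sum r \<tau>" unfolding \<tau> using assms(1) r(1) by (rule cubes_sum_pullback)
  moreover have "products_sum s \<sigma>" if "products_sum s \<tau>" for s
    by (subst \<sigma>) (rule products_sum_pullback[OF assms(2) that])
  ultimately show ?thesis unfolding comon_def using r(2) by blast
qed

definition dual_frame :: "nat set \<Rightarrow> (nat \<Rightarrow> complex ^ 'n \<Rightarrow> complex) \<Rightarrow> (nat \<Rightarrow> complex ^ 'n) \<Rightarrow> bool"
  where "dual_frame I f e \<longleftrightarrow> (\<forall>i. linform (f i)) \<and> (\<forall>i\<in>I. \<forall>j\<in>I. f i (e j) = (if i = j then 1 else 0))"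

text \<open>Once zero coefficients are dropped, the number of cubes is the rank of the flattening: a
  combination of the \<open>e j\<close> with coefficients \<open>b j\<close>, tested against
  \<open>e i\<close> twice, returns \<open>c i * b i\<close>.\<close>

lemma comon_independent_cubes:
  assumes "finite I" "dual_frame I f e"
  shows "comon (\<lambda>x y z. \<Sum>i\<in>I. c i * cub (f i) x y z)"
proof -
  define K where "K = {i \<in> I. c i \<noteq> 0}"
  have lin: "linform (f i)" for i using assms(2) by (simp add: dual_frame_def)
  have K: "(\<Sum>i\<in>I. c i * cub (f i) x y z) = (\<Sum>i\<in>K. c i * cub (f i) x y z)" for x y z
    unfolding K_def by (rule sum.mono_neutral_right) (use assms in auto)
  have "finite K" using assms(1) by (simp add: K_def)
  then obtain h where h: "bij_betw h {..<card K} K"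
    using ex_bij_betw_nat_finite[of K] by (auto simp: atLeast0LessThan)
  have fe: "f i (\<Sum>j\<in>K. b j *s e j) = b i" if "i \<in> K" for i b
  proof -
    have "f i (\<Sum>j\<in>K. b j *s e j) = (\<Sum>j\<in>K. if j = i then b j else 0)"
      unfolding linform_sum[OF lin] using assms(2) that
      by (intro sum.cong) (auto simp: linform_scale[OF lin] dual_frame_def K_def)
    then show ?thesis using that \<open>finite K\<close> by simp
  qed
  show ?thesis
  proof (rule comonI[of "\<lambda>i. f (h i)" _ "\<lambda>i. c (h i)" "card K"])
    show "linform (f (h i))" for i by (rule lin)
    show "(\<Sum>i\<in>I. c i * cub (f i) x y z) = (\<Sum>i<card K. c (h i) * cub (f (h i)) x y z)" for x y z
      unfolding K by (rule sum.reindex_bij_betw[OF h, symmetric])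
  next
    fix s u v w
    assume u: "\<And>i::nat. linform (u i)" and v: "\<And>i. linform (v i)"
      and eq: "\<And>x y z. (\<Sum>i\<in>I. c i * cub (f i) x y z) = (\<Sum>i<s. u i x * v i y * w i z)"
    have "card K + card {} \<le> s"
    proof (rule substitution_bound[OF u v eq \<open>finite K\<close> finite.emptyI])
      fix b :: "nat \<Rightarrow> complex"
      assume "\<exists>j\<in>K. b j \<noteq> 0"
      then obtain i where i: "i \<in> K" "b i \<noteq> 0" by blast
      let ?x = "\<Sum>j\<in>K. b j *s e j"
      have fi: "f j (e i) = (if j = i then 1 else 0)" if "j \<in> K" for j
        using assms(2) i that by (auto simp: dual_frame_def K_def)
      have "(\<Sum>j\<in>K. c j * cub (f j) ?x (e i) (e i)) = (\<Sum>j\<in>K. if j = i then c i * b i else 0)"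
        by (intro sum.cong) (auto simp: cub_def fe fi)
      then have "(\<Sum>j\<in>I. c j * cub (f j) ?x (e i) (e i)) = c i * b i"
        using i \<open>finite K\<close> unfolding K by simp
      then show "\<exists>y z. (\<Sum>j\<in>I. c j * cub (f j) ?x y z) \<noteq> 0"
        using i by (intro exI[of _ "e i"]) (simp add: K_def)
    qed auto
    then show "card K \<le> s" by simp
  qed
qed

text \<open>Linear independence, encoded by dual vectors because the lower bounds evaluate forms at
  exactly these vectors.\<close>

definition coframe :: "(complex ^ 'n \<Rightarrow> complex) \<Rightarrow> (complex ^ 'n \<Rightarrow> complex) \<Rightarrow> (complex ^ 'n \<Rightarrow> complex) \<Rightarrow> bool"
  where "coframe f g h \<longleftrightarrow> linform f \<and> linform g \<and> linform h \<and>
    (\<exists>a b c. f a = 1 \<and> f b = 0 \<and> f c = 0 \<and> g a = 0 \<and> g b = 1 \<and> g c = 0 \<and> h a = 0 \<and> h b = 0 \<and> h c = 1)"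

lemma coframe_swap: "coframe f g h \<Longrightarrow> coframe g f h"
  and coframe_rotate: "coframe f g h \<Longrightarrow> coframe g h f"
  unfolding coframe_def by metis+

lemma coframe_shear:
  assumes "coframe f g h" "p \<noteq> 0"
  shows "coframe (\<lambda>x. p * f x + q * g x + r * h x) g h"
proof -
  from assms(1) obtain a b c where lin: "linform f" "linform g" "linform h"
    and "f a = 1" "f b = 0" "f c = 0" "g a = 0" "g b = 1" "g c = 0" "h a = 0" "h b = 0" "h c = 1"
    unfolding coframe_def by blast
  with assms(2) show ?thesis
    unfolding coframe_def
    apply (intro conjI linform_add_fun linform_scale_fun)
    apply assumption+
    \<comment> \<open>Dual vectors change by the inverse transpose of the change of forms.\<close>
    apply (rule exI[of _ "(1/p) *s a"], rule exI[of _ "b - (q/p) *s a"], rule exI[of _ "c - (r/p) *s a"])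
    by (simp add: linform_simps[OF lin(1)] linform_simps[OF lin(2)] linform_simps[OF lin(3)])
qed

lemma comon_cubes:
  assumes "coframe f g h"
  shows "comon (\<lambda>x y z. p * cub f x y z + q * cub g x y z + r * cub h x y z)"
proof -
  from assms obtain a b c where "linform f" "linform g" "linform h"
    "f a = 1" "f b = 0" "f c = 0" "g a = 0" "g b = 1" "g c = 0" "h a = 0" "h b = 0" "h c = 1"
    unfolding coframe_def by blast
  then have "dual_frame {0,1,2} (\<lambda>i. if i = 0 then f else if i = 1 then g else h)
      (\<lambda>i. if i = 0 then a else if i = 1 then b else c)"
    by (auto simp: dual_frame_def)
  from comon_independent_cubes[OF _ this, of "\<lambda>i. if i = 0 then p else if i = 1 then q else r"]
  show ?thesis by (simp add: add.assoc)
qed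

text \<open>The polarization of \<open>6 f^2 g = (g + f)^3 + (g - f)^3 - 2 g^3\<close>.\<close>

lemma sqr_eq_cubs:
  "sqr f g x y z = 1/2 * cub (\<lambda>x. g x + f x) x y z + 1/2 * cub (\<lambda>x. g x - f x) x y z - cub g x y z"
  by (simp add: sqr_def cub_def field_simps)

text \<open>The rank is 3, or 4 if \<open>p\<close> is nonzero, one more than the rank of the
  flattening.\<close>

lemma comon_tangent_plus_cube:
  assumes "coframe f g h"
  shows "comon (\<lambda>x y z. sqr f g x y z + p * cub h x y z)"
proof -
  from assms obtain a b c where lin: "linform f" "linform g" "linform h"
    and dual: "f a = 1" "f b = 0" "f c = 0" "g a = 0" "g b = 1" "g c = 0" "h a = 0" "h b = 0" "h c = 1"
    unfolding coframe_def by blast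
  note ls = linform_simps[OF lin(1)] linform_simps[OF lin(2)] linform_simps[OF lin(3)]
  let ?\<tau> = "\<lambda>x y z. sqr f g x y z + p * cub h x y z"
  let ?e = "(!) [a, b, c]"
  let ?f = "(!) [\<lambda>x. g x + f x, \<lambda>x. g x - f x, g, h]"
  define K where "K = (if p = 0 then {0,1} else {0,1,2::nat})"
  define r where "r = (if p = 0 then 3 else 4::nat)"
  \<comment> \<open>Indices from \<open>r\<close> on fall back to 0, so that the whole family is
    linear.\<close>
  define d where "d i = (if i < r then i else 0)" for i
  show ?thesis
  proof (rule comonI[of "\<lambda>i. ?f (d i)" _ "(!) [1/2, 1/2, -1, p]" r])
    have "d i \<in> {0,1,2,3}" for i by (auto simp: d_def r_def)
    moreover have "linform (?f i)" if "i \<in> {0,1,2,3}" for i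
      using that lin by (auto intro: linform_add_fun linform_diff_fun)
    ultimately show "linform (?f (d i))" for i by blast
    show "?\<tau> x y z = (\<Sum>i<r. [1/2, 1/2, -1, p] ! i * cub (?f (d i)) x y z)" for x y z
    proof -
      have "{..<r} = (if p = 0 then {0,1,2} else {0,1,2,3})" by (auto simp: r_def)
      then show ?thesis by (simp add: sqr_eq_cubs d_def r_def)
    qed
  next
    fix s u v w
    assume u: "\<And>i::nat. linform (u i)" and v: "\<And>i. linform (v i)"
      and eq: "\<And>x y z. ?\<tau> x y z = (\<Sum>i<s. u i x * v i y * w i z)"
    \<comment> \<open>The slice at \<open>b\<close> is \<open>f f\<close> and costs one term.
      Whatever multiple \<open>s\<close> of it is added, the slice at \<open>a + c\<close> is
      \<open>f g + g f + s f f + p h h\<close>, a bilinear form of rank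
      \<open>card K\<close>.\<close>
    have "card {0::nat} + card K \<le> s"
    proof (rule substitution_bound[OF u v eq, where n = "\<lambda>_. b" and e = ?e and x = "a + c"])
      fix t :: "nat \<Rightarrow> complex"
      assume "\<exists>j\<in>{0}. t j \<noteq> 0"
      then have "?\<tau> (\<Sum>j\<in>{0}. t j *s b) a a \<noteq> 0"
        by (simp add: sqr_def cub_def ls dual)
      then show "\<exists>y z. ?\<tau> (\<Sum>j\<in>{0}. t j *s b) y z \<noteq> 0" by (intro exI)
    next
      fix s t :: "nat \<Rightarrow> complex"
      assume t: "\<exists>j\<in>K. t j \<noteq> 0"
      let ?x = "a + c + (\<Sum>j\<in>{0}. s j *s b)" and ?y = "\<Sum>j\<in>K. t j *s ?e j"
      have "?\<tau> ?x ?y b = t 0" "?\<tau> ?x ?y a = t 1 + s 0 * t 0" "p \<noteq> 0 \<Longrightarrow> ?\<tau> ?x ?y c = p * t 2"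
        by (auto simp: K_def sqr_def cub_def ls dual)
      note * = this
      consider "t 0 \<noteq> 0" | "t 0 = 0" "t 1 \<noteq> 0" | "p \<noteq> 0" "t 2 \<noteq> 0"
        using t by (auto simp: K_def split: if_splits)
      then show "\<exists>z. ?\<tau> ?x ?y z \<noteq> 0"
      proof cases
        case 1
        with *(1) show ?thesis by (intro exI[of _ b]) (simp only: not_False_eq_True)
      next
        case 2
        with *(2) show ?thesis by (intro exI[of _ a]) (simp only: mult_zero_right add_0_right not_False_eq_True)
      next
        case 3
        with *(3) show ?thesis by (intro exI[of _ c]) (simp only: mult_eq_0_iff not_False_eq_True simp_thms)
      qed
    qed (auto simp: K_def)
    then show "r \<le> s" by (auto simp: K_def r_def split: if_splits)
  qed
qed

text \<open>Five cubes suffice since the term \<open>f\<^sup>3\<close> in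
  \<open>6 f g\<^sup>2 = (f + g)\<^sup>3 + (f - g)\<^sup>3 - 2 f\<^sup>3\<close> is absorbed into \<open>f\<^sup>2 h\<close>.\<close>

lemma comon_osculating:
  assumes "coframe f g h"
  shows "comon (\<lambda>x y z. sqr f h x y z + sqr g f x y z)"
proof -
  from assms obtain a b c where lin: "linform f" "linform g" "linform h"
    and dual: "f a = 1" "f b = 0" "f c = 0" "g a = 0" "g b = 1" "g c = 0" "h a = 0" "h b = 0" "h c = 1"
    unfolding coframe_def by blast
  note ls = linform_simps[OF lin(1)] linform_simps[OF lin(2)] linform_simps[OF lin(3)]
  let ?\<tau> = "\<lambda>x y z. sqr f h x y z + sqr g f x y z"
  let ?e = "(!) [a, b, c]" and ?n = "(!) [b, c]"
  \<comment> \<open>Since \<open>sqr f f\<close> is \<open>3 * cub f\<close>, a shift by a third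
    turns \<open>sqr f h\<close> into \<open>sqr f k + cub f\<close>, and
    \<open>sqr g f + cub f\<close> is half the sum of two cubes.\<close>
  define k where "k x = h x + (-1/3) * f x" for x
  have k: "linform k" unfolding k_def using lin by (intro linform_add_fun linform_scale_fun)
  let ?f = "(!) [\<lambda>x. f x + g x, \<lambda>x. f x - g x, \<lambda>x. k x + f x, \<lambda>x. k x - f x, k]"
  define d where "d i = (if i < 5 then i else 0::nat)" for i
  show ?thesis
  proof (rule comonI[of "\<lambda>i. ?f (d i)" _ "(!) [1/2, 1/2, 1/2, 1/2, -1]" 5])
    have "d i \<in> {0,1,2,3,4}" for i by (auto simp: d_def)
    moreover have "linform (?f i)" if "i \<in> {0,1,2,3,4}" for i
      using that lin k by (auto intro: linform_add_fun linform_diff_fun)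
    ultimately show "linform (?f (d i))" for i by blast
    show "?\<tau> x y z = (\<Sum>i<5. [1/2, 1/2, 1/2, 1/2, -1] ! i * cub (?f (d i)) x y z)" for x y z
    proof -
      have "?\<tau> x y z = sqr f k x y z + (sqr g f x y z + cub f x y z)"
        by (simp add: sqr_def cub_def k_def field_simps)
      also have "\<dots> = (\<Sum>i<5. [1/2, 1/2, 1/2, 1/2, -1] ! i * cub (?f (d i)) x y z)"
      proof -
        have "{..<5} = {0,1,2,3,4::nat}" by auto
        then show ?thesis by (simp add: sqr_eq_cubs d_def)
      qed
      finally show ?thesis .
    qed
  next
    fix s u v w
    assume u: "\<And>i::nat. linform (u i)" and v: "\<And>i. linform (v i)"
      and eq: "\<And>x y z. ?\<tau> x y z = (\<Sum>i<s. u i x * v i y * w i z)"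
    \<comment> \<open>The slices at \<open>b\<close> and \<open>c\<close> are independent and cost
      two terms. Every slice at \<open>a\<close> plus a combination of them is triangular with unit
      diagonal when \<open>z\<close> runs through \<open>c\<close>, \<open>b\<close>,
      \<open>a\<close>, hence of rank 3.\<close>
    have "card {0,1::nat} + card {0,1,2::nat} \<le> s"
    proof (rule substitution_bound[OF u v eq, where n = ?n and e = ?e and x = a])
      fix t :: "nat \<Rightarrow> complex"
      assume t: "\<exists>j\<in>{0,1}. t j \<noteq> 0"
      let ?x = "\<Sum>j\<in>{0,1}. t j *s ?n j"
      have "?\<tau> ?x a a = t 1" "?\<tau> ?x a b = t 0"
        by (auto simp: sqr_def ls dual)
      note * = this
      consider "t 0 \<noteq> 0" | "t 1 \<noteq> 0" using t by auto
      then show "\<exists>y z. ?\<tau> ?x y z \<noteq> 0"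
      proof cases
        case 1
        with *(2) show ?thesis by (intro exI[of _ a] exI[of _ b]) (simp only: not_False_eq_True)
      next
        case 2
        with *(1) show ?thesis by (intro exI[of _ a]) (simp only: not_False_eq_True)
      qed
    next
      fix s t :: "nat \<Rightarrow> complex"
      assume t: "\<exists>j\<in>{0,1,2}. t j \<noteq> 0"
      let ?x = "a + (\<Sum>j\<in>{0,1}. s j *s ?n j)" and ?y = "\<Sum>j\<in>{0,1,2}. t j *s ?e j"
      have "?\<tau> ?x ?y c = t 0" "?\<tau> ?x ?y b = t 1 + s 0 * t 0" "?\<tau> ?x ?y a = t 2 + s 1 * t 0 + s 0 * t 1"
        by (auto simp: sqr_def ls dual)
      note * = this
      consider "t 0 \<noteq> 0" | "t 0 = 0" "t 1 \<noteq> 0" | "t 0 = 0" "t 1 = 0" "t 2 \<noteq> 0"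
        using t by auto
      then show "\<exists>z. ?\<tau> ?x ?y z \<noteq> 0"
      proof cases
        case 1
        with *(1) show ?thesis by (intro exI[of _ c]) (simp only: not_False_eq_True)
      next
        case 2
        with *(2) show ?thesis by (intro exI[of _ b]) (simp only: mult_zero_right add_0_right not_False_eq_True)
      next
        case 3
        with *(3) show ?thesis by (intro exI[of _ a]) (simp only: mult_zero_right add_0_right not_False_eq_True)
      qed
    qed auto
    then show "5 \<le> s" by simp
  qed
qed

section \<open>Binary cubics\<close>

lemma comon_cong: "comon \<sigma> \<Longrightarrow> (\<And>x y z. \<tau> x y z = \<sigma> x y z) \<Longrightarrow> comon \<tau>"
  by (metis ext)

text \<open>The new forms are dual to \<open>u *s b + v *s c\<close> and
  \<open>u' *s b + v' *s c\<close>; their coefficients are Cramer's rule.\<close>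

lemma coframe_recombine:
  assumes "coframe f g h" and D: "D = u * v' - v * u'" "D \<noteq> 0"
  shows "coframe f (\<lambda>x. (v' / D) * g x + (- u' / D) * h x) (\<lambda>x. (u / D) * h x + (- v / D) * g x)"
proof -
  from assms(1) obtain a b c where lin: "linform f" "linform g" "linform h"
    and dual: "f a = 1" "f b = 0" "f c = 0" "g a = 0" "g b = 1" "g c = 0" "h a = 0" "h b = 0" "h c = 1"
    unfolding coframe_def by blast
  note ls = linform_simps[OF lin(1)] linform_simps[OF lin(2)] linform_simps[OF lin(3)]
  show ?thesis
    unfolding coframe_def
    apply (intro conjI linform_add_fun linform_scale_fun)
         apply (rule lin)+
    apply (rule exI[of _ a], rule exI[of _ "u *s b + v *s c"], rule exI[of _ "u' *s b + v' *s c"])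
    using D(2) by (simp add: ls dual field_simps) (simp add: D(1) algebra_simps)
qed

text \<open>On the diagonal this is \<open>3 f^2\<close> times \<open>(p/3) f + q g + r h\<close>.
  If that linear form is independent of \<open>f\<close>, it becomes the new \<open>g\<close>;
  otherwise the cubic is a multiple of \<open>f^3\<close>.\<close>

lemma comon_square_times_linear:
  assumes "coframe f g h"
  shows "comon (\<lambda>x y z. p * cub f x y z + q * sqr f g x y z + r * sqr f h x y z)"
proof -
  have *: "comon (\<lambda>x y z. p * cub f x y z + q * sqr f g x y z + r * sqr f h x y z)"
    if co: "coframe f g h" and "q \<noteq> 0" for f g h :: "complex ^ 'a \<Rightarrow> complex" and q r
  proof -
    let ?g = "\<lambda>x. q * g x + (p / 3) * f x + r * h x"
    have "coframe f ?g h" using coframe_swap[OF coframe_shear[OF coframe_swap[OF co] \<open>q \<noteq> 0\<close>]] .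
    from comon_tangent_plus_cube[OF this, of 0] show ?thesis
      by (rule comon_cong) (simp add: cub_def sqr_def field_simps)
  qed
  show ?thesis
  proof (cases "q = 0")
    case False
    then show ?thesis using * assms by blast
  next
    case q: True
    show ?thesis
    proof (cases "r = 0")
      case True
      show ?thesis by (rule comon_cong[OF comon_cubes[OF assms, of p 0 0]]) (simp add: q True)
    next
      case False
      have "coframe f h g" using coframe_swap[OF coframe_rotate[OF coframe_rotate[OF assms]]] .
      from *[OF this False, of 0] show ?thesis by (rule comon_cong) (simp add: q)
    qed
  qed
qed

lemma comon_cube_plus_square_times_linear:
  assumes "coframe f g h"
  shows "comon (\<lambda>x y z. s * cub f x y z + p * cub g x y z + q * sqr g h x y z)"
proof (cases "q = 0")
  case True
  show ?thesis by (rule comon_cong[OF comon_cubes[OF assms, of s p 0]]) (simp add: True)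
next
  case False
  let ?h = "\<lambda>x. q * h x + (p / 3) * g x + 0 * f x"
  have "coframe h g f" using coframe_swap[OF coframe_rotate[OF assms]] .
  from coframe_shear[OF this False] have "coframe ?h g f" .
  from comon_tangent_plus_cube[OF coframe_swap[OF this], of s]
  show ?thesis by (rule comon_cong) (simp add: cub_def sqr_def field_simps)
qed

lemma quadratic_form_root: "\<exists>u v. (u \<noteq> 0 \<or> v \<noteq> 0) \<and> a * u\<^sup>2 + b * (u * v) + c * v\<^sup>2 = (0::complex)"
proof (cases "a = 0")
  case True
  then show ?thesis by (intro exI[of _ 1] exI[of _ 0]) simp
next
  case False
  define s where "s = csqrt (b\<^sup>2 - 4 * a * c)"
  have s: "s * s = b * b - 4 * a * c" by (simp add: s_def power2_eq_square[symmetric])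
  have "a * ((s - b) / (2 * a))\<^sup>2 + b * ((s - b) / (2 * a) * 1) + c * 1\<^sup>2 = (s * s - b * b + 4 * a * c) / (4 * a)"
    using False by (simp add: field_simps power2_eq_square)
  also have "\<dots> = 0" by (simp add: s)
  finally show ?thesis by (metis one_neq_zero)
qed

lemma singular_kernel2:
  fixes p q r s :: complex
  assumes "p * s = q * r"
  shows "\<exists>u v. (u \<noteq> 0 \<or> v \<noteq> 0) \<and> p * u + q * v = 0 \<and> r * u + s * v = 0"
proof (cases "p = 0 \<and> q = 0")
  case True
  show ?thesis
  proof (cases "r = 0 \<and> s = 0")
    case r: True
    with True show ?thesis by (intro exI[of _ 1]) simp
  next
    case False
    with True show ?thesis by (intro exI[of _ "- s"] exI[of _ r]) auto
  qed
next
  case False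
  then show ?thesis
    using assms by (intro exI[of _ "- q"] exI[of _ p]) (auto simp: algebra_simps)
qed

text \<open>\<open>E1\<close> and \<open>E2\<close> are the slices of the binary cubic at the two
  basis vectors. With \<open>w = (u, v)\<close> and \<open>w' = (u', v')\<close> the coefficients on
  the right are the values of the polarized cubic at \<open>w w w\<close>, \<open>w w w'\<close>,
  \<open>w w' w'\<close> and \<open>w' w' w'\<close>.\<close>

lemma binary_cubic_substitution:
  fixes g0 g1 g2 g3 u v u' v' :: complex
  assumes "\<And>x. g x = u * k x + u' * l x" "\<And>x. h x = v * k x + v' * l x"
  defines "E1 s t s' t' \<equiv> g0 * s * s' + g1 * (s * t' + t * s') + g2 * t * t'"
    and "E2 s t s' t' \<equiv> g1 * s * s' + g2 * (s * t' + t * s') + g3 * t * t'"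
  shows "g0 * cub g x y z + g1 * sqr g h x y z + g2 * sqr h g x y z + g3 * cub h x y z =
    (u * E1 u v u v + v * E2 u v u v) * cub k x y z + (u' * E1 u v u v + v' * E2 u v u v) * sqr k l x y z
    + (u' * E1 u v u' v' + v' * E2 u v u' v') * sqr l k x y z
    + (u' * E1 u' v' u' v' + v' * E2 u' v' u' v') * cub l x y z"
  unfolding cub_def sqr_def assms by algebra

text \<open>A root \<open>(u, v)\<close> of the Hessian has a conjugate \<open>(u', v')\<close> with respect to the cubic. If they are
  independent, the cubic is a sum of two cubes, otherwise a square times a linear form.\<close>

lemma comon_cube_plus_binary:
  assumes co: "coframe f g h"
  shows "comon (\<lambda>x y z. s * cub f x y z +
    (g0 * cub g x y z + g1 * sqr g h x y z + g2 * sqr h g x y z + g3 * cub h x y z))"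
proof -
  define E1 where "E1 s t s' t' = g0 * s * s' + g1 * (s * t' + t * s') + g2 * t * t'" for s t s' t'
  define E2 where "E2 s t s' t' = g1 * s * s' + g2 * (s * t' + t * s') + g3 * t * t'" for s t s' t'
  obtain u v where uv: "u \<noteq> 0 \<or> v \<noteq> 0"
    and "(g0 * g2 - g1 * g1) * u\<^sup>2 + (g0 * g3 - g1 * g2) * (u * v) + (g1 * g3 - g2 * g2) * v\<^sup>2 = 0"
    using quadratic_form_root by blast
  \<comment> \<open>The Hessian vanishes where the slice at \<open>(u, v)\<close> is a singular
    matrix; a kernel vector of that matrix is the conjugate.\<close>
  then have "(g0 * u + g1 * v) * (g2 * u + g3 * v) = (g1 * u + g2 * v) * (g1 * u + g2 * v)"
    by (simp add: power2_eq_square algebra_simps)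
  from singular_kernel2[OF this] obtain u' v' where uv': "u' \<noteq> 0 \<or> v' \<noteq> 0"
    and E: "(g0 * u + g1 * v) * u' + (g1 * u + g2 * v) * v' = 0"
      "(g1 * u + g2 * v) * u' + (g2 * u + g3 * v) * v' = 0" by blast
  have E0: "E1 u v u' v' = 0" "E2 u v u' v' = 0"
    using E by (simp_all add: E1_def E2_def algebra_simps)
  have subst: "coframe f k l \<and>
      (\<forall>x y z. g0 * cub g x y z + g1 * sqr g h x y z + g2 * sqr h g x y z + g3 * cub h x y z =
    (u * E1 u v u v + v * E2 u v u v) * cub k x y z + (q * E1 u v u v + q' * E2 u v u v) * sqr k l x y z
    + (q * E1 u v q q' + q' * E2 u v q q') * sqr l k x y z
    + (q * E1 q q' q q' + q' * E2 q q' q q') * cub l x y z)"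
    if D: "D = u * q' - v * q" "D \<noteq> 0"
      and kl: "k = (\<lambda>x. (q' / D) * g x + (- q / D) * h x)" "l = (\<lambda>x. (u / D) * h x + (- v / D) * g x)"
    for D q q' k l
  proof -
    have "coframe f k l" unfolding kl by (rule coframe_recombine[OF co D])
    moreover have "g x = u * k x + q * l x" for x
      using D(2) by (simp add: kl field_simps) (simp add: D(1) algebra_simps)
    moreover have "h x = v * k x + q' * l x" for x
      using D(2) by (simp add: kl field_simps) (simp add: D(1) algebra_simps)
    ultimately show ?thesis
      unfolding E1_def E2_def using binary_cubic_substitution[of g u k q l h v q'] by blast
  qed
  show ?thesis
  proof (cases "u * v' - v * u' = 0")
    case False
    obtain k l where co': "coframe f k l"
      and eq: "\<And>x y z. g0 * cub g x y z + g1 * sqr g h x y z + g2 * sqr h g x y z + g3 * cub h x y z =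
        (u * E1 u v u v + v * E2 u v u v) * cub k x y z + (u' * E1 u v u v + v' * E2 u v u v) * sqr k l x y z
        + (u' * E1 u v u' v' + v' * E2 u v u' v') * sqr l k x y z
        + (u' * E1 u' v' u' v' + v' * E2 u' v' u' v') * cub l x y z"
      using subst[OF refl False refl refl] by blast
    \<comment> \<open>Both sides are the value at \<open>w w w'\<close>, so conjugacy removes the
      term \<open>sqr k l\<close> along with \<open>sqr l k\<close>.\<close>
    have "u' * E1 u v u v + v' * E2 u v u v = u * E1 u v u' v' + v * E2 u v u' v'"
      by (simp add: E1_def E2_def algebra_simps)
    then have "u' * E1 u v u v + v' * E2 u v u v = 0" by (simp add: E0)
    then show ?thesis
      using comon_cubes[OF co', of s "u * E1 u v u v + v * E2 u v u v" "u' * E1 u' v' u' v' + v' * E2 u' v' u' v'"]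
      by (elim comon_cong) (simp add: eq E0)
  next
    case True
    have "\<exists>m. m \<noteq> 0 \<and> u' = m * u \<and> v' = m * v"
    proof (cases "u = 0")
      case u0: True
      with uv True uv' show ?thesis by (intro exI[of _ "v' / v"]) auto
    next
      case False
      with True uv' show ?thesis by (intro exI[of _ "u' / u"]) (auto simp: field_simps)
    qed
    then obtain m where m: "m \<noteq> 0" "u' = m * u" "v' = m * v" by blast
    \<comment> \<open>A parallel conjugate makes \<open>(u, v)\<close> conjugate to itself. In any
      basis completing it, the coefficients of \<open>cub k\<close> and \<open>sqr k l\<close>
      vanish, and what remains is divisible by \<open>l^2\<close>.\<close>
    have "m * E1 u v u v = 0" "m * E2 u v u v = 0"
      using E0 by (simp_all add: E1_def E2_def m algebra_simps)
    with m(1) have E00: "E1 u v u v = 0" "E2 u v u v = 0" by auto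
    obtain q q' where q: "u * q' - v * q \<noteq> 0"
      using uv by (metis diff_zero mult.right_neutral mult_zero_right diff_0 neg_equal_0_iff_equal)
    obtain k l where co': "coframe f k l"
      and eq: "\<And>x y z. g0 * cub g x y z + g1 * sqr g h x y z + g2 * sqr h g x y z + g3 * cub h x y z =
        (u * E1 u v u v + v * E2 u v u v) * cub k x y z + (q * E1 u v u v + q' * E2 u v u v) * sqr k l x y z
        + (q * E1 u v q q' + q' * E2 u v q q') * sqr l k x y z
        + (q * E1 q q' q q' + q' * E2 q q' q q') * cub l x y z"
      using subst[OF refl q refl refl] by blast
    have "coframe f l k" using coframe_swap[OF coframe_rotate[OF coframe_rotate[OF co']]] .
    from comon_cube_plus_square_times_linear[OF this, of s "q * E1 q q' q q' + q' * E2 q q' q q'" "q * E1 u v q q' + q' * E2 u v q q'"]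
    show ?thesis by (rule comon_cong) (simp add: eq E00)
  qed
qed

section \<open>Ternary cubics with vanishing Aronhold invariant\<close>

definition symmetric_trilinear :: "(complex ^ 'n \<Rightarrow> complex ^ 'n \<Rightarrow> complex ^ 'n \<Rightarrow> complex) \<Rightarrow> bool"
  where "symmetric_trilinear \<tau> \<longleftrightarrow> (\<forall>y z. linform (\<lambda>x. \<tau> x y z)) \<and>
    (\<forall>x y z. \<tau> x y z = \<tau> y x z) \<and> (\<forall>x y z. \<tau> x y z = \<tau> x z y)"

lemma symmetric_trilinear_swap:
  assumes "symmetric_trilinear \<tau>"
  shows "\<tau> x y z = \<tau> y x z" "\<tau> x y z = \<tau> x z y" "\<tau> x y z = \<tau> z y x"
    and "\<tau> x y z = \<tau> y z x" "\<tau> x y z = \<tau> z x y"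
  using assms unfolding symmetric_trilinear_def by metis+

lemma symmetric_trilinear_linform:
  assumes "symmetric_trilinear \<tau>"
  shows "linform (\<lambda>x. \<tau> x y z)" "linform (\<lambda>x. \<tau> y x z)" "linform (\<lambda>x. \<tau> y z x)"
proof -
  show *: "linform (\<lambda>x. \<tau> x y z)" for y z using assms by (simp add: symmetric_trilinear_def)
  show "linform (\<lambda>x. \<tau> y x z)" using *[of y z] by (simp add: symmetric_trilinear_swap(1)[OF assms, of y])
  show "linform (\<lambda>x. \<tau> y z x)" using *[of y z] by (simp add: symmetric_trilinear_swap(4)[OF assms, of _ y])
qed

section \<open>Bases and coordinates in three variables\<close>

lemma linform_coords:
  assumes "linform f"
  shows "f x = (\<Sum>i\<in>UNIV. x $ i * f (axis i 1))"
proof -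
  have "f x = f (\<Sum>i\<in>UNIV. x $ i *s axis i 1)" by (simp add: basis_expansion)
  then show ?thesis by (simp add: linform_sum[OF assms] linform_scale[OF assms])
qed

text \<open>Phrased for a list: in \<open>vec.independent\<close> of a set, equal vectors would be
  merged.\<close>

definition independent3 :: "complex ^ 'n \<Rightarrow> complex ^ 'n \<Rightarrow> complex ^ 'n \<Rightarrow> bool"
  where "independent3 a b c \<longleftrightarrow>
    (\<forall>p q r. p *s a + q *s b + r *s c = 0 \<longrightarrow> p = 0 \<and> q = 0 \<and> r = 0)"

lemma coordinates_of_independent3:
  fixes a b c :: "complex ^ 3"
  assumes "independent3 a b c"
  obtains f g h where "coframe f g h" "\<And>x. x = f x *s a + g x *s b + h x *s c"
proof -
  define A :: "complex ^ 3 ^ 3" where "A = (\<chi> i j. vector [a, b, c] $ j $ i)"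
  have Av: "A *v x = x $ 1 *s a + x $ 2 *s b + x $ 3 *s c" for x
    by (simp add: vec_eq_iff matrix_vector_mult_def A_def sum_3 mult.commute)
  have "x = 0" if "A *v x = 0" for x
  proof -
    have "x $ 1 = 0 \<and> x $ 2 = 0 \<and> x $ 3 = 0"
      using assms that unfolding independent3_def Av by blast
    then show ?thesis by (subst vec_eq_iff) (simp only: forall_3 zero_index)
  qed
  then obtain B where BA: "B ** A = mat 1" using matrix_left_invertible_ker[of A] by blast
  then have AB: "A ** B = mat 1" using matrix_left_right_inverse by blast
  have lin: "linform (\<lambda>x. (B *v x) $ i)" for i
    by (simp add: linform_def vec.add vec.scale)
  have x: "x = (B *v x) $ 1 *s a + (B *v x) $ 2 *s b + (B *v x) $ 3 *s c" for x
  proof -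
    have "A *v (B *v x) = x" by (simp add: matrix_vector_mul_assoc AB)
    then show ?thesis unfolding Av by (rule sym)
  qed
  have coord: "B *v (p *s a + q *s b + r *s c) = vector [p, q, r]" for p q r
  proof -
    have "B *v (A *v vector [p, q, r]) = vector [p, q, r]" by (simp add: matrix_vector_mul_assoc BA)
    then show ?thesis unfolding Av by simp
  qed
  have "B *v a = vector [1, 0, 0]" "B *v b = vector [0, 1, 0]" "B *v c = vector [0, 0, 1]"
    using coord[of 1 0 0] coord[of 0 1 0] coord[of 0 0 1] by simp_all
  then have "coframe (\<lambda>x. (B *v x) $ 1) (\<lambda>x. (B *v x) $ 2) (\<lambda>x. (B *v x) $ 3)"
    unfolding coframe_def by (intro conjI lin exI[of _ a] exI[of _ b] exI[of _ c]) simp_all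
  with x that show thesis by blast
qed

lemma extend_to_independent3:
  fixes a b :: "complex ^ 3"
  assumes "\<And>p q. p *s a + q *s b = 0 \<Longrightarrow> p = 0 \<and> q = 0"
  obtains c where "independent3 a b c"
proof -
  have "vec.span {a, b} \<noteq> UNIV"
  proof
    assume "vec.span {a, b} = UNIV"
    then have "vec.dim {a, b} = 3"
      using vec.dim_span[of "{a, b}"] vec_dim_card[where 'a = complex and 'n = 3] by simp
    moreover have "vec.dim {a, b} \<le> card {a, b}" by (rule vec.dim_le_card') simp
    moreover have "card {a, b} \<le> 2" by (simp add: card_insert_if)
    ultimately show False by simp
  qed
  then obtain c where c: "c \<notin> vec.span {a, b}" by blast
  have "independent3 a b c"
    unfolding independent3_def
  proof (intro allI impI)
    fix p q r
    assume *: "p *s a + q *s b + r *s c = 0"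
    have "r = 0"
    proof (rule ccontr)
      assume "r \<noteq> 0"
      have "r *s c = - (p *s a + q *s b)" by (rule minus_unique[OF *, symmetric])
      then have "r *s c \<in> vec.span {a, b}"
        by (simp only:) (intro vec.span_neg vec.span_add vec.span_scale vec.span_base, auto)
      then have "(1 / r) *s (r *s c) \<in> vec.span {a, b}" by (rule vec.span_scale)
      then have "c \<in> vec.span {a, b}" using \<open>r \<noteq> 0\<close> by simp
      with c show False by simp
    qed
    with * assms[of p q] show "p = 0 \<and> q = 0 \<and> r = 0" by simp
  qed
  then show thesis by (rule that)
qed

lemma extend_nonzero_to_independent3:
  fixes a :: "complex ^ 3"
  assumes "a \<noteq> 0"
  obtains b c where "independent3 a b c"
proof -
  have "vec.span {a} \<noteq> UNIV"
  proof
    assume "vec.span {a} = UNIV"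
    then have "vec.dim {a} = 3"
      using vec.dim_span[of "{a}"] vec_dim_card[where 'a = complex and 'n = 3] by simp
    moreover have "vec.dim {a} \<le> card {a}" by (rule vec.dim_le_card') simp
    ultimately show False by simp
  qed
  then obtain b where b: "b \<notin> vec.span {a}" by blast
  have "p = 0 \<and> q = 0" if "p *s a + q *s b = 0" for p q
  proof -
    have "q = 0"
    proof (rule ccontr)
      assume "q \<noteq> 0"
      have "q *s b = - (p *s a)" by (rule minus_unique[OF that, symmetric])
      then have "q *s b \<in> vec.span {a}"
        by (simp only:) (intro vec.span_neg vec.span_scale vec.span_base, auto)
      then have "(1 / q) *s (q *s b) \<in> vec.span {a}" by (rule vec.span_scale)
      then have "b \<in> vec.span {a}" using \<open>q \<noteq> 0\<close> by simp
      with b show False by simp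
    qed
    with that assms show ?thesis by simp
  qed
  from extend_to_independent3[of a b, OF this] show thesis using that by blast
qed

lemma singular_matrix_in_pencil:
  fixes A B :: "complex ^ 3 ^ 3"
  assumes "det B \<noteq> 0"
  obtains t where "det (\<chi> i j. A $ i $ j + t * B $ i $ j) = 0"
proof -
  define d where "d t = det (\<chi> i j. A $ i $ j + t * B $ i $ j)" for t
  \<comment> \<open>The determinant is a cubic in \<open>t\<close>, whose middle coefficients are read off at \<open>t = 1, -1\<close>.\<close>
  define c2 where "c2 = (d 1 + d (- 1)) / 2 - det A"
  define c1 where "c1 = (d 1 - d (- 1)) / 2 - det B"
  have d: "d t = det A + c1 * t + c2 * t\<^sup>2 + det B * t ^ 3" for t
    unfolding c1_def c2_def d_def det_3 vec_lambda_beta by (simp add: field_simps power2_eq_square power3_eq_cube)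
  have "\<not> constant (poly [:det A, c1, c2, det B:])"
    using assms by (simp add: constant_degree)
  then obtain t where "poly [:det A, c1, c2, det B:] t = 0"
    using fundamental_theorem_of_algebra by blast
  then have "d t = 0" unfolding d by (simp add: algebra_simps power2_eq_square power3_eq_cube)
  then show thesis unfolding d_def by (rule that)
qed

text \<open>The determinant of the slice is restricted to the line through two coordinate vectors.
  If the slice at the first is regular, this is a polynomial of degree 3 in \<open>t\<close> and has
  a root; \<open>k\<close> is then a kernel vector of the slice.\<close>

lemma singular_slice:
  fixes \<tau> :: "complex ^ 3 \<Rightarrow> complex ^ 3 \<Rightarrow> complex ^ 3 \<Rightarrow> complex"
  assumes "symmetric_trilinear \<tau>"
  obtains a k where "a \<noteq> 0" "k \<noteq> 0" "\<And>z. \<tau> a k z = 0"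
proof -
  note lin = symmetric_trilinear_linform[OF assms]
  define M where "M a = (\<chi> i j. \<tau> a (axis i 1) (axis j 1))" for a
  have M: "M (a + t *s b) = (\<chi> i j. M a $ i $ j + t * M b $ i $ j)" for a b t
    by (simp add: M_def vec_eq_iff linform_add[OF lin(1)] linform_scale[OF lin(1)])
  have "\<exists>a. a \<noteq> 0 \<and> det (M a) = 0"
  proof (cases "det (M (axis 1 1)) = 0")
    case True
    then show ?thesis by (intro exI[of _ "axis 1 1"]) (simp add: axis_eq_0_iff)
  next
    case False
    then obtain t where t: "det (M (axis 2 1 + t *s axis 1 1)) = 0"
      using singular_matrix_in_pencil[OF False, of "M (axis 2 1)"] unfolding M by blast
    have "(axis 2 1 + t *s axis 1 1 :: complex ^ 3) $ 2 \<noteq> 0" by (simp add: axis_def)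
    then have "(axis 2 1 + t *s axis 1 1 :: complex ^ 3) \<noteq> 0" by (metis zero_index)
    with t show ?thesis by blast
  qed
  then obtain a where a: "a \<noteq> 0" "det (M a) = 0" by blast
  then obtain k where k: "k \<noteq> 0" "M a *v k = 0"
    using matrix_left_invertible_ker[of "M a"] invertible_left_inverse[of "M a"] invertible_det_nz[of "M a"]
    by blast
  have "\<tau> a k (axis i 1) = (M a *v k) $ i" for i
    by (subst linform_coords[OF lin(2)])
      (simp add: M_def matrix_vector_mult_def mult.commute symmetric_trilinear_swap(2)[OF assms, of a _ "axis i 1"])
  then have "\<tau> a k z = 0" for z
    by (subst linform_coords[OF lin(3)]) (simp add: k)
  with a k that show thesis by blast
qed

lemma symmetric_trilinear_expand:
  fixes \<tau> :: "complex ^ 'n \<Rightarrow> complex ^ 'n \<Rightarrow> complex ^ 'n \<Rightarrow> complex"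
  assumes sym: "symmetric_trilinear \<tau>" and co: "\<And>x. x = f x *s a + g x *s b + h x *s c"
  shows "\<tau> x y z = \<tau> a a a * cub f x y z + \<tau> b b b * cub g x y z + \<tau> c c c * cub h x y z
    + \<tau> a a b * sqr f g x y z + \<tau> a a c * sqr f h x y z + \<tau> a b b * sqr g f x y z
    + \<tau> a c c * sqr h f x y z + \<tau> b b c * sqr g h x y z + \<tau> b c c * sqr h g x y z
    + \<tau> a b c * (f x * g y * h z + f x * h y * g z + g x * f y * h z
      + g x * h y * f z + h x * f y * g z + h x * g y * f z)"
proof -
  have lin: "F x = f x * F a + g x * F b + h x * F c" if "linform F" for F x
  proof -
    have "F x = F (f x *s a + g x *s b + h x *s c)" by (rule arg_cong[OF co])
    then show ?thesis by (simp add: linform_add[OF that] linform_scale[OF that])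
  qed
  note l = symmetric_trilinear_linform[OF sym]
  note swap = symmetric_trilinear_swap[OF sym]
  have perms: "\<tau> a b a = \<tau> a a b" "\<tau> b a a = \<tau> a a b" "\<tau> a c a = \<tau> a a c" "\<tau> c a a = \<tau> a a c"
    "\<tau> b a b = \<tau> a b b" "\<tau> b b a = \<tau> a b b" "\<tau> c a c = \<tau> a c c" "\<tau> c c a = \<tau> a c c"
    "\<tau> b c b = \<tau> b b c" "\<tau> c b b = \<tau> b b c" "\<tau> c b c = \<tau> b c c" "\<tau> c c b = \<tau> b c c"
    "\<tau> a c b = \<tau> a b c" "\<tau> b a c = \<tau> a b c" "\<tau> b c a = \<tau> a b c" "\<tau> c a b = \<tau> a b c" "\<tau> c b a = \<tau> a b c"
    using swap by metis+
  have 1: "\<tau> x y z = f x * \<tau> a y z + g x * \<tau> b y z + h x * \<tau> c y z" by (rule lin[OF l(1)])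
  have 2: "\<tau> u y z = f y * \<tau> u a z + g y * \<tau> u b z + h y * \<tau> u c z" for u by (rule lin[OF l(2)])
  have 3: "\<tau> u v z = f z * \<tau> u v a + g z * \<tau> u v b + h z * \<tau> u v c" for u v by (rule lin[OF l(3)])
  show ?thesis
    unfolding 1 unfolding 2 unfolding 3 unfolding perms cub_def sqr_def
    by (simp add: algebra_simps)
qed

text \<open>The pairing of two covectors by the adjugate of a symmetric \<open>3 \<times> 3\<close> matrix.\<close>

definition adjugate_pairing where
  "adjugate_pairing m11 m12 m13 m22 m23 m33 u1 u2 u3 w1 w2 w3 =
    (m22 * m33 - m23 * m23) * u1 * w1 + (m11 * m33 - m13 * m13) * u2 * w2 + (m11 * m22 - m12 * m12) * u3 * w3
    + (m13 * m23 - m12 * m33) * (u1 * w2 + u2 * w1) + (m12 * m23 - m13 * m22) * (u1 * w3 + u3 * w1)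
    + (m12 * m13 - m11 * m23) * (u2 * w3 + u3 * (w2 :: complex))"

text \<open>The Aronhold invariant, as an entry of the commutator condition
  \<open>A adj(B) C = C adj(B) A\<close> for the three slices of the tensor.\<close>

definition aronhold ::
  "(complex ^ 'n \<Rightarrow> complex ^ 'n \<Rightarrow> complex ^ 'n \<Rightarrow> complex) \<Rightarrow> complex ^ 'n \<Rightarrow> complex ^ 'n \<Rightarrow> complex ^ 'n \<Rightarrow> complex"
  where "aronhold \<tau> a b c =
    adjugate_pairing (\<tau> a a b) (\<tau> a b b) (\<tau> a b c) (\<tau> b b b) (\<tau> b b c) (\<tau> b c c)
      (\<tau> a a a) (\<tau> a a b) (\<tau> a a c) (\<tau> a c c) (\<tau> b c c) (\<tau> c c c) -
    adjugate_pairing (\<tau> a a b) (\<tau> a b b) (\<tau> a b c) (\<tau> b b b) (\<tau> b b c) (\<tau> b c c)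
      (\<tau> a a c) (\<tau> a b c) (\<tau> a c c) (\<tau> a a c) (\<tau> a b c) (\<tau> a c c)"

text \<open>No monomial contains both \<open>f\<close> and \<open>g\<close>. If
  \<open>\<tau> a a a\<close> or \<open>\<tau> k k k\<close> is nonzero, the cubic is reduced to a
  cube plus a binary cubic in the other two forms; if both vanish, it is \<open>h\<close> times a
  quadratic form up to one term, which the invariant excludes after a choice between
  \<open>a\<close> and \<open>k\<close>.\<close>

lemma comon_of_polar_pair:
  fixes \<tau> :: "complex ^ 3 \<Rightarrow> complex ^ 3 \<Rightarrow> complex ^ 3 \<Rightarrow> complex"
  assumes sym: "symmetric_trilinear \<tau>" and S: "\<And>a b c. aronhold \<tau> a b c = 0"
    and ind: "\<And>p q. p *s a + q *s k = 0 \<Longrightarrow> p = 0 \<and> q = 0"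
    and ak: "\<And>z. \<tau> a k z = 0"
  shows "comon \<tau>"
proof -
  note swap = symmetric_trilinear_swap[OF sym]
  note lin = symmetric_trilinear_linform[OF sym]
  have off_diagonal: "comon \<tau>" if ind: "\<And>p q. p *s a + q *s k = 0 \<Longrightarrow> p = 0 \<and> q = 0"
    and ak: "\<And>z. \<tau> a k z = 0" and aaa: "\<tau> a a a \<noteq> 0" for a k
  proof -
    obtain n where n: "independent3 a k n" using extend_to_independent3 ind by blast
    \<comment> \<open>Correcting by a multiple of \<open>a\<close> removes the term
      \<open>sqr f h\<close>.\<close>
    define m where "m = n - (\<tau> a a n / \<tau> a a a) *s a"
    have m: "\<tau> a a m = 0"
      using aaa by (simp add: m_def linform_diff[OF lin(3)] linform_scale[OF lin(3)])
    have "independent3 a k m"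
      unfolding independent3_def
    proof (intro allI impI)
      fix p q r
      assume *: "p *s a + q *s k + r *s m = 0"
      have "(p - r * (\<tau> a a n / \<tau> a a a)) *s a + q *s k + r *s n = p *s a + q *s k + r *s m"
        by (simp add: m_def vec_eq_iff algebra_simps)
      then have "p - r * (\<tau> a a n / \<tau> a a a) = 0 \<and> q = 0 \<and> r = 0"
        using n unfolding independent3_def * by blast
      then show "p = 0 \<and> q = 0 \<and> r = 0" by simp
    qed
    then obtain f g h where co: "coframe f g h" and x: "\<And>x. x = f x *s a + g x *s k + h x *s m"
      by (rule coordinates_of_independent3) blast
    define \<alpha> \<beta> g0 g1 g2 g3 where
      coeffs: "\<alpha> = \<tau> a a a" "\<beta> = \<tau> a m m" "g0 = \<tau> k k k" "g1 = \<tau> k k m" "g2 = \<tau> k m m" "g3 = \<tau> m m m"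
    have zero: "\<tau> a k k = 0" "\<tau> a k m = 0" "\<tau> a a k = 0"
      using ak[of k] ak[of m] ak[of a] swap(2)[of a k a] by simp_all
    have \<tau>: "\<tau> x y z = \<alpha> * cub f x y z + \<beta> * sqr h f x y z +
        (g0 * cub g x y z + g1 * sqr g h x y z + g2 * sqr h g x y z + g3 * cub h x y z)" for x y z
      using symmetric_trilinear_expand[OF sym x, of x y z] by (simp add: zero m coeffs algebra_simps)
    have rot: "coframe g f h" "coframe g h f" "coframe h f g" "coframe f h g"
      using co coframe_swap coframe_rotate by blast+
    have "\<alpha> * \<beta> * (g0 * g2 - g1 * g1) = 0"
      using S[of a k m] by (simp add: aronhold_def adjugate_pairing_def zero m coeffs algebra_simps)
    moreover have "\<alpha> \<noteq> 0" using aaa by (simp add: coeffs)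
    ultimately have "\<beta> = 0 \<or> g0 * g2 = g1 * g1" by simp
    moreover have "g1 = 0" if "g0 * g2 = g1 * g1" "g0 = 0" using that by simp
    ultimately consider "\<beta> = 0" | "g0 * g2 = g1 * g1" "g0 \<noteq> 0" | "g0 = 0" "g1 = 0" "g2 \<noteq> 0" | "g0 = 0" "g1 = 0" "g2 = 0"
      by blast
    then show ?thesis
    proof cases
      case 1
      show ?thesis
        by (rule comon_cong[OF comon_cube_plus_binary[OF co, of \<alpha> g0 g1 g2 g3]]) (simp add: \<tau> 1)
    next
      case 2
      \<comment> \<open>The relation \<open>g0 * g2 = g1 * g1\<close> lets the part in
        \<open>g\<close>, \<open>h\<close> be completed to \<open>g0 (g + p h)^3\<close> plus a
        multiple of \<open>h^3\<close>, which joins the part in \<open>f\<close>,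
        \<open>h\<close>.\<close>
      define p where "p = g1 / g0"
      have g: "g1 = p * g0" "g2 = p * p * g0"
        using 2 by (simp_all add: p_def field_simps)
      have "coframe (\<lambda>x. 1 * g x + 0 * f x + p * h x) f h"
        by (rule coframe_shear[OF rot(1)]) simp
      from comon_cube_plus_binary[OF this, of g0 \<alpha> 0 \<beta> "g3 - p * p * p * g0"]
      show ?thesis by (rule comon_cong) (simp add: \<tau> g cub_def sqr_def algebra_simps)
    next
      case 3
      \<comment> \<open>Apart from \<open>f^3\<close> everything is divisible by \<open>h^2\<close>,
        so \<open>g2 * g + \<beta> * f\<close> can serve as a single variable.\<close>
      have "coframe (\<lambda>x. g2 * g x + \<beta> * f x + 0 * h x) f h" using coframe_shear[OF rot(1) 3(3)] .
      then have "coframe f h (\<lambda>x. g2 * g x + \<beta> * f x + 0 * h x)" by (rule coframe_rotate)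
      from comon_cube_plus_binary[OF this, of \<alpha> g3 1 0 0]
      show ?thesis by (rule comon_cong) (simp add: \<tau> 3(1,2) cub_def sqr_def algebra_simps)
    next
      case 4
      from comon_cube_plus_binary[OF rot(1), of 0 \<alpha> 0 \<beta> g3]
      show ?thesis by (rule comon_cong) (simp add: \<tau> 4)
    qed
  qed
  have on_diagonal: "comon \<tau>" if ind: "\<And>p q. p *s a + q *s k = 0 \<Longrightarrow> p = 0 \<and> q = 0"
    and ak: "\<And>z. \<tau> a k z = 0" and m: "independent3 a k m"
    and aaa: "\<tau> a a a = 0" and kkk: "\<tau> k k k = 0" and kkm: "\<tau> k k m = 0" for a k m
  proof -
    from m obtain f g h where co: "coframe f g h" and x: "\<And>x. x = f x *s a + g x *s k + h x *s m"
      by (rule coordinates_of_independent3) blast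
    define p r s t where coeffs: "p = \<tau> a a m" "r = \<tau> a m m" "s = \<tau> k m m" "t = \<tau> m m m"
    have zero: "\<tau> a k k = 0" "\<tau> a k m = 0" "\<tau> a a k = 0"
      using ak[of k] ak[of m] ak[of a] swap(2)[of a k a] by simp_all
    have \<tau>: "\<tau> x y z = p * sqr f h x y z + r * sqr h f x y z + s * sqr h g x y z + t * cub h x y z" for x y z
      using symmetric_trilinear_expand[OF sym x, of x y z] by (simp add: zero aaa kkk kkm coeffs algebra_simps)
    have rot: "coframe g f h" "coframe g h f" "coframe h f g" "coframe f h g"
      using co coframe_swap coframe_rotate by blast+
    \<comment> \<open>The cubic is \<open>h\<close> times a quadratic form: for \<open>p = 0\<close>
      it is \<open>h^2\<close> times a linear form, for \<open>s = 0\<close> it is binary, and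
      otherwise it is a conic together with its tangent line \<open>h\<close>.\<close>
    consider "p = 0" | "p \<noteq> 0" "s = 0" | "p \<noteq> 0" "s \<noteq> 0" by blast
    then show ?thesis
    proof cases
      case 1
      from comon_square_times_linear[OF rot(3), of t r s]
      show ?thesis by (rule comon_cong) (simp add: \<tau> 1)
    next
      case 2
      from comon_cube_plus_binary[OF rot(1), of 0 0 p r t]
      show ?thesis by (rule comon_cong) (simp add: \<tau> 2)
    next
      case 3
      define q where "q = csqrt p"
      have q: "p = q * q" "q \<noteq> 0" using 3(1) by (simp_all add: q_def power2_eq_square[symmetric])
      \<comment> \<open>Completing the square:
        \<open>(q f + e h)^2 = p f^2 + r f h + e^2 h^2\<close> with \<open>e = r / (2 q)\<close>,
        and \<open>d = t/3 - e^2\<close> is the remaining multiple of \<open>h^2\<close>, absorbed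
        into the multiple of \<open>g\<close>.\<close>
      define d where "d = t / 3 - r * r / (4 * (q * q))"
      have t: "t = 3 * d + 3 * (r / (2 * q)) * (r / (2 * q))" by (simp add: d_def)
      define e where "e = r / (2 * q)"
      have r: "r = 2 * q * e" using q(2) by (simp add: e_def)
      let ?g = "\<lambda>x. s * g x + d * h x + 0 * f x"
      let ?f = "\<lambda>x. q * f x + 0 * ?g x + e * h x"
      have "coframe ?g h f" by (rule coframe_shear[OF rot(2) 3(2)])
      then have "coframe f ?g h" by (rule coframe_rotate[OF coframe_rotate])
      from coframe_shear[OF this q(2)] have "coframe ?f ?g h" .
      then have "coframe h ?f ?g" by (rule coframe_rotate[OF coframe_rotate])
      from comon_osculating[OF this] show ?thesis
        by (rule comon_cong) (simp add: \<tau> q(1) t[folded e_def] r cub_def sqr_def algebra_simps)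
    qed
  qed
  have ka: "\<tau> k a z = 0" for z using ak swap(1) by metis
  have ind': "p = 0 \<and> q = 0" if "p *s k + q *s a = 0" for p q
    using ind[of q p] that by (simp add: add.commute)
  consider "\<tau> a a a \<noteq> 0" | "\<tau> k k k \<noteq> 0" | "\<tau> a a a = 0" "\<tau> k k k = 0" by blast
  then show ?thesis
  proof cases
    case 1
    then show ?thesis using off_diagonal[of a k] ind ak by blast
  next
    case 2
    then show ?thesis using off_diagonal[of k a] ind' ka by blast
  next
    case 3
    obtain m where m: "independent3 a k m" using extend_to_independent3 ind by blast
    then have m': "independent3 k a m" unfolding independent3_def by (metis add.commute)
    have zero: "\<tau> a k k = 0" "\<tau> a k m = 0" "\<tau> a a k = 0"
      using ak[of k] ak[of m] ak[of a] swap(2)[of a k a] by simp_all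
    \<comment> \<open>Here the invariant reduces to a square, so \<open>g^2 h\<close> or
      \<open>f^2 h\<close> is absent; exchanging \<open>a\<close> and \<open>k\<close> reduces the
      second case to the first.\<close>
    have "(\<tau> k k m * \<tau> a a m) * (\<tau> k k m * \<tau> a a m) = 0"
      using S[of a k m] by (simp add: aronhold_def adjugate_pairing_def zero 3)
    then consider "\<tau> k k m = 0" | "\<tau> a a m = 0" by auto
    then show ?thesis
    proof cases
      case 1
      then show ?thesis using on_diagonal[of a k m] ind ak m 3 by blast
    next
      case 2
      then show ?thesis using on_diagonal[of k a m] ind' ka m' 3 by blast
    qed
  qed
qed

text \<open>The kernel vector \<open>k\<close> may be proportional to \<open>a\<close>. Then
  \<open>\<tau> a a z = 0\<close>, and the invariant is the square of the determinant of the slice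
  at \<open>a\<close> on the span of \<open>b\<close> and \<open>c\<close>; its vanishing yields a
  second kernel vector, independent of \<open>a\<close>.\<close>

lemma comon_ternary:
  fixes \<tau> :: "complex ^ 3 \<Rightarrow> complex ^ 3 \<Rightarrow> complex ^ 3 \<Rightarrow> complex"
  assumes sym: "symmetric_trilinear \<tau>" and S: "\<And>a b c. aronhold \<tau> a b c = 0"
  shows "comon \<tau>"
proof -
  note swap = symmetric_trilinear_swap[OF sym]
  note lin = symmetric_trilinear_linform[OF sym]
  obtain a k where a: "a \<noteq> 0" and k: "k \<noteq> 0" and ak: "\<And>z. \<tau> a k z = 0"
    using singular_slice[OF sym] by blast
  show ?thesis
  proof (cases "\<forall>p q. p *s a + q *s k = 0 \<longrightarrow> p = 0 \<and> q = 0")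
    case True
    then show ?thesis using comon_of_polar_pair[OF sym S _ ak] by blast
  next
    case False
    then obtain p q where pq: "p *s a + q *s k = 0" "p \<noteq> 0 \<or> q \<noteq> 0" by blast
    have "q \<noteq> 0"
    proof
      assume "q = 0"
      with pq a show False by simp
    qed
    have "p \<noteq> 0"
    proof
      assume "p = 0"
      with pq k show False by simp
    qed
    have aa: "\<tau> a a z = 0" for z
    proof -
      have "\<tau> a (p *s a + q *s k) z = 0" by (simp add: pq(1) linform_0[OF lin(2)])
      then show ?thesis using \<open>p \<noteq> 0\<close> by (simp add: linform_add[OF lin(2)] linform_scale[OF lin(2)] ak)
    qed
    obtain b c where abc: "independent3 a b c" using extend_nonzero_to_independent3[OF a] .
    obtain f g h where x: "\<And>x. x = f x *s a + g x *s b + h x *s c"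
      using coordinates_of_independent3[OF abc] by blast
    have "(\<tau> a b b * \<tau> a c c - \<tau> a b c * \<tau> a b c) * (\<tau> a b b * \<tau> a c c - \<tau> a b c * \<tau> a b c) = 0"
      using S[of a b c] by (simp add: aronhold_def adjugate_pairing_def aa algebra_simps)
    then have "\<tau> a b b * \<tau> a c c = \<tau> a b c * \<tau> a b c" by simp
    from singular_kernel2[OF this] obtain u v where uv: "u \<noteq> 0 \<or> v \<noteq> 0"
      and eq: "\<tau> a b b * u + \<tau> a b c * v = 0" "\<tau> a b c * u + \<tau> a c c * v = 0" by blast
    let ?k = "u *s b + v *s c"
    have "\<tau> a ?k b = 0" "\<tau> a ?k c = 0" "\<tau> a ?k a = 0"
      using eq swap(2)[of a c b] swap(2)[of a b a] swap(2)[of a c a]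
      by (simp_all add: linform_add[OF lin(2)] linform_scale[OF lin(2)] aa mult.commute)
    then have ak': "\<tau> a ?k z = 0" for z
      using arg_cong[OF x[of z], of "\<tau> a ?k"] by (simp only: linform_add[OF lin(3)] linform_scale[OF lin(3)]) simp
    have "p = 0 \<and> q = 0" if "p *s a + q *s ?k = 0" for p q
    proof -
      have "p *s a + (q * u) *s b + (q * v) *s c = 0" using that by (simp add: vec_eq_iff algebra_simps)
      then have "p = 0 \<and> q * u = 0 \<and> q * v = 0" using abc unfolding independent3_def by blast
      with uv show ?thesis by auto
    qed
    from comon_of_polar_pair[OF sym S this ak'] show ?thesis by blast
  qed
qed

section \<open>Limits of sums of three cubes\<close>

text \<open>Bilinear, without the conjugation of an inner product, so that vectors and linear forms
  correspond linearly.\<close>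

definition pairing :: "complex ^ 'n \<Rightarrow> complex ^ 'n \<Rightarrow> complex"
  where "pairing u x = (\<Sum>i\<in>UNIV. u $ i * x $ i)"

lemma linform_pairing: "linform (pairing u)"
  by (simp add: linform_def pairing_def sum.distrib sum_distrib_left algebra_simps)

lemma linform_eq_pairing: "linform f \<Longrightarrow> f = pairing (\<chi> i. f (axis i 1))"
  unfolding pairing_def by (rule ext, subst linform_coords[of f]) (simp_all add: mult.commute)

text \<open>The tensor as a trilinear form on the dual space, which \<open>pairing\<close>
  identifies with the same coordinates; the cube of \<open>x\<close> becomes the cube of the form
  \<open>pairing x\<close>.\<close>

definition tform ::
  "complex ^ ('n::finite \<times> 'n \<times> 'n) \<Rightarrow> complex ^ 'n \<Rightarrow> complex ^ 'n \<Rightarrow> complex ^ 'n \<Rightarrow> complex"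
  where "tform T x y z = (\<Sum>i\<in>UNIV. \<Sum>j\<in>UNIV. \<Sum>k\<in>UNIV. T $ (i, j, k) * x $ i * y $ j * z $ k)"

lemma tform_add: "tform (S + T) x y z = tform S x y z + tform T x y z"
  by (simp add: tform_def sum.distrib algebra_simps)

lemma tform_scale: "tform (c *s T) x y z = c * tform T x y z"
  by (simp add: tform_def sum_distrib_left algebra_simps)

lemma tform_0: "tform 0 x y z = 0"
  by (simp add: tform_def)

lemma tform_sum: "tform (\<Sum>i\<in>I. T i) x y z = (\<Sum>i\<in>I. tform (T i) x y z)"
  by (induction I rule: infinite_finite_induct) (simp_all add: tform_0 tform_add)

lemma tform_tensor3: "tform (tensor3 u v w) x y z = pairing u x * pairing v y * pairing w z"
proof -
  have "pairing u x * pairing v y * pairing w z =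
      (\<Sum>i\<in>UNIV. (u $ i * x $ i) * (\<Sum>j\<in>UNIV. (v $ j * y $ j) * (\<Sum>k\<in>UNIV. w $ k * z $ k)))"
    unfolding pairing_def by (simp only: sum_distrib_right mult.assoc)
  then show ?thesis
    by (simp add: tform_def tensor3_def sum_distrib_left mult.assoc mult.left_commute)
qed

lemma tform_cube: "tform (cube u) x y z = cub (pairing u) x y z"
  by (simp add: cube_def tform_tensor3 cub_def)

lemma tform_axis: "tform T (axis i 1) (axis j 1) (axis k 1) = T $ (i, j, k)"
proof -
  have *: "(\<Sum>l\<in>UNIV. f l * axis i 1 $ l) = f i" for f :: "'a::finite \<Rightarrow> complex" and i
    by (simp add: axis_def if_distrib cong: if_cong)
  show ?thesis
    unfolding tform_def by (simp only: * sum_distrib_right[symmetric])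
qed

lemma tform_eqI:
  assumes "\<And>x y z. tform S x y z = tform T x y z"
  shows "S = T"
  using assms by (simp add: vec_eq_iff flip: tform_axis)

lemma continuous_on_tform: "continuous_on A (\<lambda>T. tform T x y z)"
  unfolding tform_def by (intro continuous_intros)

text \<open>Moving the scalar into the first factor turns a sum of \<open>s\<close> cubes into a sum
  of \<open>s\<close> products. One lower bound therefore makes \<open>r\<close> the minimum in both
  definitions.\<close>

lemma symmetric_rank_eq_tensor_rank:
  fixes T :: "complex ^ ('n::finite \<times> 'n \<times> 'n)"
  assumes "comon (tform T)"
  shows "symmetric_rank T = tensor_rank T"
proof -
  obtain r where "cubes_sum r (tform T)" and least: "\<And>s. products_sum s (tform T) \<Longrightarrow> r \<le> s"
    using assms unfolding comon_def by blast
  then obtain c f where lin: "\<forall>i. linform (f i)" and f: "\<forall>x y z. tform T x y z = (\<Sum>i<r. c i * cub (f i) x y z)"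
    unfolding cubes_sum_def by (elim exE conjE) (rule that)
  define x where "x i = (\<chi> j. f i (axis j 1))" for i
  have fx: "f i = pairing (x i)" for i
    unfolding x_def using lin by (intro linform_eq_pairing) simp
  have T: "T = (\<Sum>i<r. c i *s cube (x i))"
    by (rule tform_eqI) (simp add: f tform_sum tform_scale tform_cube fx)
  have cubes: "c *s cube y = tensor3 (c *s y) y y" for c and y :: "complex ^ 'n"
    by (simp add: cube_def tensor3_def vec_eq_iff split: prod.splits)
  have least': "r \<le> s" if "T = (\<Sum>i<s. tensor3 (u i) (v i) (w i))" for s u v w
  proof (rule least)
    show "products_sum s (tform T)"
      unfolding products_sum_def
    proof (rule exI[of _ "\<lambda>i. pairing (u i)"], rule exI[of _ "\<lambda>i. pairing (v i)"],
        rule exI[of _ "\<lambda>i. pairing (w i)"], intro conjI allI linform_pairing)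
      show "tform T x y z = (\<Sum>i<s. pairing (u i) x * pairing (v i) y * pairing (w i) z)" for x y z
        by (simp add: that tform_sum tform_tensor3)
    qed
  qed
  have "symmetric_rank T = r"
    unfolding symmetric_rank_def
  proof (rule Least_equality)
    show "\<exists>c x. T = (\<Sum>i<r. c i *s cube (x i))" using T by blast
    show "r \<le> s" if "\<exists>c x. T = (\<Sum>i<s. c i *s cube (x i))" for s
    proof -
      from that obtain c x where "T = (\<Sum>i<s. c i *s cube (x i))" by blast
      then have "T = (\<Sum>i<s. tensor3 (c i *s x i) (x i) (x i))" unfolding cubes .
      then show ?thesis by (rule least')
    qed
  qed
  moreover have "tensor_rank T = r"
    unfolding tensor_rank_def
  proof (rule Least_equality)
    show "\<exists>u v w. T = (\<Sum>i<r. tensor3 (u i) (v i) (w i))"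
    proof -
      have "T = (\<Sum>i<r. tensor3 (c i *s x i) (x i) (x i))" using T unfolding cubes .
      then show ?thesis
        by - (rule exI[of _ "\<lambda>i. c i *s x i"], rule exI[of _ x], rule exI[of _ x], assumption)
    qed
    show "r \<le> s" if "\<exists>u v w. T = (\<Sum>i<s. tensor3 (u i) (v i) (w i))" for s
      using that least' by blast
  qed
  ultimately show ?thesis by simp
qed

section \<open>From limiting planes to the closure of the sums of three cubes\<close>

definition cube_sums3 :: "(complex ^ ('n::finite \<times> 'n \<times> 'n)) set"
  where "cube_sums3 = {p *s cube x + q *s cube y + r *s cube z | p q r x y z. True}"

text \<open>The coordinates of \<open>T\<close> in the limit frame are kept fixed and applied to the
  converging frames; the resulting points \<open>S t\<close> lie in the spans of three cubes and
  tend to \<open>T\<close>.\<close>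

lemma secant3_cone_subset_closure:
  "secant3_cone veronese_cone \<subseteq> closure (cube_sums3 :: (complex ^ ('n::finite \<times> 'n \<times> 'n)) set)"
proof
  fix T :: "complex ^ ('n \<times> 'n \<times> 'n)"
  assume "T \<in> secant3_cone veronese_cone"
  then consider "T = 0" | x1 x2 x3 L where "x1 ` {0<..1::real} \<subseteq> veronese_cone"
      "x2 ` {0<..1} \<subseteq> veronese_cone" "x3 ` {0<..1} \<subseteq> veronese_cone"
      "subspace_tendsto (\<lambda>t. vec.span {x1 t, x2 t, x3 t}) L (at_right 0)" "T \<in> L"
    unfolding secant3_cone_def by auto
  then show "T \<in> closure cube_sums3"
  proof cases
    case 1
    have "T = 0 *s cube 0 + 0 *s cube 0 + 0 *s cube 0" by (simp add: 1)
    then have "T \<in> cube_sums3" unfolding cube_sums3_def by blast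
    then show ?thesis using closure_subset by blast
  next
    case 2
    from 2(4) obtain k e b where
      ev: "\<forall>\<^sub>F t in at_right 0. frame_of k (\<lambda>i. e i t) (vec.span {x1 t, x2 t, x3 t})"
      and b: "frame_of k b L" and lim: "\<And>i. i < k \<Longrightarrow> ((\<lambda>t. e i t) \<longlongrightarrow> b i) (at_right (0::real))"
      unfolding subspace_tendsto_def by blast
    from b \<open>T \<in> L\<close> have inj: "inj_on b {..<k}" and "T \<in> vec.span (b ` {..<k})"
      by (auto simp: frame_of_def)
    then obtain c where "T = (\<Sum>v\<in>b ` {..<k}. c v *s v)"
      by (auto simp: vec.span_finite)
    then have T: "T = (\<Sum>i<k. c (b i) *s b i)" by (simp add: sum.reindex[OF inj])
    define S where "S t = (\<Sum>i<k. c (b i) *s e i t)" for t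
    have "(S \<longlongrightarrow> T) (at_right 0)"
      unfolding S_def T
    proof (rule vec_tendstoI)
      show "((\<lambda>t. (\<Sum>i<k. c (b i) *s e i t) $ l) \<longlongrightarrow> (\<Sum>i<k. c (b i) *s b i) $ l) (at_right 0)" for l
        by (simp add: sum_component) (intro tendsto_intros lim, simp)
    qed
    moreover have "S t \<in> closure cube_sums3"
      if fr: "frame_of k (\<lambda>i. e i t) (vec.span {x1 t, x2 t, x3 t})" and t: "t \<in> {0<..<1}" for t
    proof -
      have "vec.span ((\<lambda>i. e i t) ` {..<k}) = vec.span {x1 t, x2 t, x3 t}"
        using fr by (simp add: frame_of_def)
      moreover have "e i t \<in> vec.span ((\<lambda>i. e i t) ` {..<k})" if "i < k" for i
        using that by (intro vec.span_base imageI) simp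
      ultimately have "e i t \<in> vec.span {x1 t, x2 t, x3 t}" if "i < k" for i
        using that by metis
      then have "S t \<in> vec.span {x1 t, x2 t, x3 t}"
        unfolding S_def by (intro vec.span_sum vec.span_scale) simp
      then have "\<exists>p q r. S t - p *s x1 t - q *s x2 t - r *s x3 t = 0"
        by (simp only: vec.span_insert vec.span_empty mem_Collect_eq singleton_iff)
      then obtain p q r where "S t - p *s x1 t - q *s x2 t - r *s x3 t = 0" by blast
      then have St: "S t = p *s x1 t + q *s x2 t + r *s x3 t" by (simp add: algebra_simps)
      have "x1 t \<in> veronese_cone" "x2 t \<in> veronese_cone" "x3 t \<in> veronese_cone"
        using 2(1-3) t by (auto simp: image_subset_iff)
      then obtain c1 c2 c3 y1 y2 y3 where "x1 t = c1 *s cube y1" "x2 t = c2 *s cube y2" "x3 t = c3 *s cube y3"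
        unfolding veronese_cone_def by blast
      then have "S t = (p * c1) *s cube y1 + (q * c2) *s cube y2 + (r * c3) *s cube y3"
        by (simp add: St vector_smult_assoc)
      then have "S t \<in> cube_sums3" unfolding cube_sums3_def by blast
      then show ?thesis using closure_subset by blast
    qed
    then have "\<forall>\<^sub>F t in at_right 0. S t \<in> closure cube_sums3"
      using eventually_conj[OF ev eventually_at_right_real[of 0 1]] by (auto elim: eventually_mono)
    ultimately show ?thesis
      by (intro Lim_in_closed_set[OF closed_closure]) auto
  qed
qed

text \<open>Binet--Cauchy: the adjugate of \<open>\<Sum>\<^sub>i d\<^sub>i p\<^sub>i p\<^sub>i\<^sup>T\<close> pairs the \<open>p\<^sub>i\<close> orthogonally.\<close>

lemma adjugate_pairing_sum_of_squares:
  fixes d1 d2 d3 x1 x2 x3 y1 y2 y3 z1 z2 z3 k1 k2 k3 l1 l2 l3 :: complex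
  defines "D \<equiv> x1 * (y2 * z3 - y3 * z2) - x2 * (y1 * z3 - y3 * z1) + x3 * (y1 * z2 - y2 * z1)"
  shows "adjugate_pairing
      (d1 * x1 * x1 + d2 * y1 * y1 + d3 * z1 * z1) (d1 * x1 * x2 + d2 * y1 * y2 + d3 * z1 * z2)
      (d1 * x1 * x3 + d2 * y1 * y3 + d3 * z1 * z3) (d1 * x2 * x2 + d2 * y2 * y2 + d3 * z2 * z2)
      (d1 * x2 * x3 + d2 * y2 * y3 + d3 * z2 * z3) (d1 * x3 * x3 + d2 * y3 * y3 + d3 * z3 * z3)
      (k1 * x1 + k2 * y1 + k3 * z1) (k1 * x2 + k2 * y2 + k3 * z2) (k1 * x3 + k2 * y3 + k3 * z3)
      (l1 * x1 + l2 * y1 + l3 * z1) (l1 * x2 + l2 * y2 + l3 * z2) (l1 * x3 + l2 * y3 + l3 * z3)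
    = D * D * (d2 * d3 * k1 * l1 + d1 * d3 * k2 * l2 + d1 * d2 * k3 * l3)"
proof -
  \<comment> \<open>The adjugate of a weighted sum of squares of three vectors is the sum over pairs
    of the weighted squares of their cross products. Each factor below is a determinant, and for a
    combination of the three vectors it is, up to sign, one coefficient times
    \<open>D\<close>.\<close>
  have cross: "adjugate_pairing
      (d1 * x1 * x1 + d2 * y1 * y1 + d3 * z1 * z1) (d1 * x1 * x2 + d2 * y1 * y2 + d3 * z1 * z2)
      (d1 * x1 * x3 + d2 * y1 * y3 + d3 * z1 * z3) (d1 * x2 * x2 + d2 * y2 * y2 + d3 * z2 * z2)
      (d1 * x2 * x3 + d2 * y2 * y3 + d3 * z2 * z3) (d1 * x3 * x3 + d2 * y3 * y3 + d3 * z3 * z3)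
      u1 u2 u3 w1 w2 w3
    = d1 * d2 * (u1 * (x2 * y3 - x3 * y2) - u2 * (x1 * y3 - x3 * y1) + u3 * (x1 * y2 - x2 * y1))
        * (w1 * (x2 * y3 - x3 * y2) - w2 * (x1 * y3 - x3 * y1) + w3 * (x1 * y2 - x2 * y1))
    + d1 * d3 * (u1 * (x2 * z3 - x3 * z2) - u2 * (x1 * z3 - x3 * z1) + u3 * (x1 * z2 - x2 * z1))
        * (w1 * (x2 * z3 - x3 * z2) - w2 * (x1 * z3 - x3 * z1) + w3 * (x1 * z2 - x2 * z1))
    + d2 * d3 * (u1 * (y2 * z3 - y3 * z2) - u2 * (y1 * z3 - y3 * z1) + u3 * (y1 * z2 - y2 * z1))
        * (w1 * (y2 * z3 - y3 * z2) - w2 * (y1 * z3 - y3 * z1) + w3 * (y1 * z2 - y2 * z1))"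
    for u1 u2 u3 w1 w2 w3
    unfolding adjugate_pairing_def by (simp add: algebra_simps)
  have 1: "(k1 * x1 + k2 * y1 + k3 * z1) * (x2 * y3 - x3 * y2) - (k1 * x2 + k2 * y2 + k3 * z2) * (x1 * y3 - x3 * y1)
      + (k1 * x3 + k2 * y3 + k3 * z3) * (x1 * y2 - x2 * y1) = k3 * D" for k1 k2 k3
    unfolding D_def by (simp add: algebra_simps)
  have 2: "(k1 * x1 + k2 * y1 + k3 * z1) * (x2 * z3 - x3 * z2) - (k1 * x2 + k2 * y2 + k3 * z2) * (x1 * z3 - x3 * z1)
      + (k1 * x3 + k2 * y3 + k3 * z3) * (x1 * z2 - x2 * z1) = - (k2 * D)" for k1 k2 k3
    unfolding D_def by (simp add: algebra_simps)
  have 3: "(k1 * x1 + k2 * y1 + k3 * z1) * (y2 * z3 - y3 * z2) - (k1 * x2 + k2 * y2 + k3 * z2) * (y1 * z3 - y3 * z1)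
      + (k1 * x3 + k2 * y3 + k3 * z3) * (y1 * z2 - y2 * z1) = k1 * D" for k1 k2 k3
    unfolding D_def by (simp add: algebra_simps)
  show ?thesis unfolding cross 1 2 3 by (simp add: algebra_simps)
qed

text \<open>The slice at \<open>b\<close> is diagonal in \<open>X\<close>, \<open>Y\<close>,
  \<open>Z\<close>, which evaluates both pairings through products of coefficients. They agree
  because \<open>(p X(a)^2) (p X(c)^2) = (p X(a) X(c))^2\<close>, and likewise for \<open>Y\<close>
  and \<open>Z\<close>.\<close>

lemma aronhold_cube_sums3:
  assumes "T \<in> cube_sums3"
  shows "aronhold (tform T) a b c = 0"
proof -
  obtain p q r x y z where T: "T = p *s cube x + q *s cube y + r *s cube z"
    using assms unfolding cube_sums3_def by blast
  define X where "X = pairing x"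
  define Y where "Y = pairing y"
  define Z where "Z = pairing z"
  have \<tau>: "tform T u v w = (p * X w) * X u * X v + (q * Y w) * Y u * Y v + (r * Z w) * Z u * Z v" for u v w
    by (simp add: T tform_add tform_scale tform_cube cub_def X_def Y_def Z_def)
  have slice: "tform T a a b = (p * X b) * X a * X a + (q * Y b) * Y a * Y a + (r * Z b) * Z a * Z a"
    "tform T a b b = (p * X b) * X a * X b + (q * Y b) * Y a * Y b + (r * Z b) * Z a * Z b"
    "tform T a b c = (p * X b) * X a * X c + (q * Y b) * Y a * Y c + (r * Z b) * Z a * Z c"
    "tform T b b b = (p * X b) * X b * X b + (q * Y b) * Y b * Y b + (r * Z b) * Z b * Z b"
    "tform T b b c = (p * X b) * X b * X c + (q * Y b) * Y b * Y c + (r * Z b) * Z b * Z c"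
    "tform T b c c = (p * X b) * X c * X c + (q * Y b) * Y c * Y c + (r * Z b) * Z c * Z c"
    by (simp_all add: \<tau>)
  \<comment> \<open>The values at \<open>a a c\<close> and \<open>a c c\<close> occur twice with
    different groupings: they are entries of the covectors of \<open>a a\<close> and
    \<open>c c\<close>, and again of the covector of \<open>a c\<close>.\<close>
  have rows: "tform T a a a = (p * X a * X a) * X a + (q * Y a * Y a) * Y a + (r * Z a * Z a) * Z a"
    "tform T a a b = (p * X a * X a) * X b + (q * Y a * Y a) * Y b + (r * Z a * Z a) * Z b"
    "tform T a a c = (p * X a * X a) * X c + (q * Y a * Y a) * Y c + (r * Z a * Z a) * Z c"
    "tform T a c c = (p * X c * X c) * X a + (q * Y c * Y c) * Y a + (r * Z c * Z c) * Z a"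
    "tform T b c c = (p * X c * X c) * X b + (q * Y c * Y c) * Y b + (r * Z c * Z c) * Z b"
    "tform T c c c = (p * X c * X c) * X c + (q * Y c * Y c) * Y c + (r * Z c * Z c) * Z c"
    "tform T a a c = (p * X a * X c) * X a + (q * Y a * Y c) * Y a + (r * Z a * Z c) * Z a"
    "tform T a b c = (p * X a * X c) * X b + (q * Y a * Y c) * Y b + (r * Z a * Z c) * Z b"
    "tform T a c c = (p * X a * X c) * X c + (q * Y a * Y c) * Y c + (r * Z a * Z c) * Z c"
    by (simp_all add: \<tau>)
  define ad where "ad u1 u2 u3 w1 w2 w3 = adjugate_pairing (tform T a a b) (tform T a b b) (tform T a b c)
    (tform T b b b) (tform T b b c) (tform T b c c) u1 u2 u3 w1 w2 w3" for u1 u2 u3 w1 w2 w3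
  obtain D where ad: "\<And>k1 k2 k3 l1 l2 l3. ad
      (k1 * X a + k2 * Y a + k3 * Z a) (k1 * X b + k2 * Y b + k3 * Z b) (k1 * X c + k2 * Y c + k3 * Z c)
      (l1 * X a + l2 * Y a + l3 * Z a) (l1 * X b + l2 * Y b + l3 * Z b) (l1 * X c + l2 * Y c + l3 * Z c)
    = D * ((q * Y b) * (r * Z b) * k1 * l1 + (p * X b) * (r * Z b) * k2 * l2 + (p * X b) * (q * Y b) * k3 * l3)"
    using adjugate_pairing_sum_of_squares[of "p * X b" "X a" "q * Y b" "Y a" "r * Z b" "Z a" "X b" "Y b" "Z b" "X c" "Y c" "Z c"]
    unfolding ad_def slice by blast
  have 1: "ad (tform T a a a) (tform T a a b) (tform T a a c) (tform T a c c) (tform T b c c) (tform T c c c) =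
    D * ((q * Y b) * (r * Z b) * (p * X a * X a) * (p * X c * X c) + (p * X b) * (r * Z b) * (q * Y a * Y a) * (q * Y c * Y c)
      + (p * X b) * (q * Y b) * (r * Z a * Z a) * (r * Z c * Z c))"
    unfolding rows(1-6) by (rule ad)
  have 2: "ad (tform T a a c) (tform T a b c) (tform T a c c) (tform T a a c) (tform T a b c) (tform T a c c) =
    D * ((q * Y b) * (r * Z b) * (p * X a * X c) * (p * X a * X c) + (p * X b) * (r * Z b) * (q * Y a * Y c) * (q * Y a * Y c)
      + (p * X b) * (q * Y b) * (r * Z a * Z c) * (r * Z a * Z c))"
    unfolding rows(7-9) by (rule ad)
  show ?thesis
    unfolding aronhold_def ad_def[symmetric] 1 2 by (simp add: algebra_simps)
qed

section \<open>Conditions that pass to the closure\<close>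

lemma symmetric_trilinear_cube_sums3:
  assumes "T \<in> cube_sums3"
  shows "tform T x y z = tform T y x z" "tform T x y z = tform T x z y"
  using assms by (auto simp: cube_sums3_def tform_add tform_scale tform_cube cub_def)

lemma linform_tform: "linform (\<lambda>x. tform T x y z)"
  by (simp add: linform_def tform_def sum.distrib sum_distrib_left algebra_simps)

lemma closure_cube_sums3_eq:
  assumes "continuous_on UNIV f" "continuous_on UNIV g" "\<And>T. T \<in> cube_sums3 \<Longrightarrow> f T = (g T :: complex)"
    and "T \<in> closure cube_sums3"
  shows "f T = g T"
proof -
  have "closed {T. f T = g T}" using assms(1,2) by (rule closed_Collect_eq)
  moreover have "cube_sums3 \<subseteq> {T. f T = g T}" using assms(3) by blast
  ultimately have "closure cube_sums3 \<subseteq> {T. f T = g T}" by (rule closure_minimal[rotated])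
  with assms(4) show ?thesis by blast
qed

lemma symmetric_trilinear_closure:
  assumes "T \<in> closure cube_sums3"
  shows "symmetric_trilinear (tform T)"
  unfolding symmetric_trilinear_def
proof (intro conjI allI linform_tform)
  show "tform T x y z = tform T y x z" for x y z
    using assms by (rule closure_cube_sums3_eq[rotated 3])
      (auto intro: continuous_on_tform symmetric_trilinear_cube_sums3)
  show "tform T x y z = tform T x z y" for x y z
    using assms by (rule closure_cube_sums3_eq[rotated 3])
      (auto intro: continuous_on_tform symmetric_trilinear_cube_sums3)
qed

lemma aronhold_closure:
  assumes "T \<in> closure cube_sums3"
  shows "aronhold (tform T) a b c = 0"
  using assms
proof (rule closure_cube_sums3_eq[rotated 3])
  show "continuous_on UNIV (\<lambda>T. aronhold (tform T) a b c)"
    unfolding aronhold_def adjugate_pairing_def by (intro continuous_intros continuous_on_tform)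
qed (simp_all add: aronhold_cube_sums3)

text \<open>Three linear forms have a common nontrivial zero among the combinations of four vectors.
  The coefficients are normalized so that they stay in a compact set when a limit is taken.\<close>

lemma four_vectors_cube_sums3:
  fixes v :: "4 \<Rightarrow> complex ^ 'n"
  assumes "T \<in> cube_sums3"
  obtains c :: "complex ^ 4" where "norm c = 1" "\<And>y z. tform T (\<Sum>j\<in>UNIV. c $ j *s v j) y z = 0"
proof -
  obtain p q r x1 x2 x3 where T: "T = p *s cube x1 + q *s cube x2 + r *s cube x3"
    using assms unfolding cube_sums3_def by blast
  define u where "u i = pairing (if i = 0 then x1 else if i = 1 then x2 else x3)" for i :: nat
  have "\<exists>c. (\<exists>j\<in>UNIV. c j \<noteq> 0) \<and> (\<forall>i\<in>{0,1,2}. u i (\<Sum>j\<in>UNIV. c j *s v j) = 0)"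
  proof (rule ccontr)
    assume "\<not> ?thesis"
    then have "\<exists>i\<in>{0,1,2}. u i (\<Sum>j\<in>UNIV. c j *s v j) \<noteq> 0" if "\<exists>j\<in>UNIV. c j \<noteq> 0" for c
      using that by blast
    from shift_into_kernels[where x = 0 and u = u, OF _ _ _ this]
    have "card (UNIV :: 4 set) \<le> card {0, 1, 2 :: nat}"
      unfolding u_def using linform_pairing by force
    then show False by simp
  qed
  then obtain c where c: "\<exists>j. c j \<noteq> 0" and "\<forall>i\<in>{0,1,2}. u i (\<Sum>j\<in>UNIV. c j *s v j) = 0" by auto
  then have "pairing x1 (\<Sum>j\<in>UNIV. c j *s v j) = 0" "pairing x2 (\<Sum>j\<in>UNIV. c j *s v j) = 0"
    "pairing x3 (\<Sum>j\<in>UNIV. c j *s v j) = 0" by (simp_all add: u_def)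
  then have zero: "tform T (\<Sum>j\<in>UNIV. c j *s v j) y z = 0" for y z
    by (simp add: T tform_add tform_scale tform_cube cub_def)
  define C where "C = (\<chi> j. c j)"
  have "C \<noteq> 0" using c by (auto simp: C_def vec_eq_iff)
  define s where "s = inverse (norm C)"
  have "norm (s *\<^sub>R C) = 1" using \<open>C \<noteq> 0\<close> by (simp add: s_def)
  moreover have "tform T (\<Sum>j\<in>UNIV. (s *\<^sub>R C) $ j *s v j) y z = 0" for y z
  proof -
    have "(\<Sum>j\<in>UNIV. (s *\<^sub>R C) $ j *s v j) = of_real s *s (\<Sum>j\<in>UNIV. c j *s v j)"
      by (simp add: vec_eq_iff C_def sum_distrib_left)
        (simp add: scaleR_conv_of_real mult.assoc)
    then show ?thesis by (simp add: linform_scale[OF linform_tform] zero)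
  qed
  ultimately show thesis by (rule that)
qed

text \<open>This condition is existential, not an equation between continuous functions; a
  convergent subsequence of the unit coefficient vectors supplies the witness.\<close>

lemma four_vectors_closure:
  fixes v :: "4 \<Rightarrow> complex ^ 'n"
  assumes "T \<in> closure cube_sums3"
  obtains c :: "complex ^ 4" where "c \<noteq> 0" "\<And>y z. tform T (\<Sum>j\<in>UNIV. c $ j *s v j) y z = 0"
proof -
  obtain S where S: "\<And>n. S n \<in> cube_sums3" "S \<longlonglongrightarrow> T"
    using assms unfolding closure_sequential by blast
  have "\<exists>c :: complex ^ 4. norm c = 1 \<and> (\<forall>y z. tform (S n) (\<Sum>j\<in>UNIV. c $ j *s v j) y z = 0)" for n
    using four_vectors_cube_sums3[OF S(1)[of n], of v] by blast
  then obtain c :: "nat \<Rightarrow> complex ^ 4" where c: "\<And>n. norm (c n) = 1"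
    and zero: "\<And>n y z. tform (S n) (\<Sum>j\<in>UNIV. c n $ j *s v j) y z = 0" by metis
  have "compact (sphere (0 :: complex ^ 4) 1)" by simp
  moreover have "\<forall>n. c n \<in> sphere 0 1" using c by simp
  ultimately obtain l r where l: "l \<in> sphere 0 1" and r: "strict_mono r" "(c \<circ> r) \<longlonglongrightarrow> l"
    unfolding compact_def by blast
  have lim: "(\<lambda>n. S (r n)) \<longlonglongrightarrow> T" "(\<lambda>n. c (r n)) \<longlonglongrightarrow> l"
    using LIMSEQ_subseq_LIMSEQ[OF S(2) r(1)] r(2) by (simp_all add: o_def)
  have "tform T (\<Sum>j\<in>UNIV. l $ j *s v j) y z = 0" for y z
  proof -
    have "(\<lambda>n. tform (S (r n)) (\<Sum>j\<in>UNIV. c (r n) $ j *s v j) y z) \<longlonglongrightarrow>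
        tform T (\<Sum>j\<in>UNIV. l $ j *s v j) y z"
      unfolding tform_def sum_component vector_smult_component
      by (intro tendsto_intros lim)
    then show ?thesis unfolding zero by (simp add: LIMSEQ_const_iff)
  qed
  moreover have "l \<noteq> 0" using l by auto
  ultimately show thesis using that by blast
qed

text \<open>A maximal system independent modulo the radical has at most three members. Coordinates
  with respect to it give \<open>g\<close>, its combinations give \<open>h\<close>, and
  \<open>x - h (g x)\<close> always lies in the radical; so the form is a pullback along
  \<open>g\<close> of its own pullback along \<open>h\<close>.\<close>

lemma comon_of_closure:
  fixes T :: "complex ^ ('n::finite \<times> 'n \<times> 'n)"
  assumes T: "T \<in> closure cube_sums3"
  shows "comon (tform T)"
proof -
  define \<tau> where "\<tau> = tform T"
  have sym: "symmetric_trilinear \<tau>" unfolding \<tau>_def by (rule symmetric_trilinear_closure[OF T])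
  note lin = symmetric_trilinear_linform[OF sym]
  define rad where "rad = {x. \<forall>y z. \<tau> x y z = 0}"
  have rad: "vec.subspace rad"
    by (simp add: vec.subspace_def rad_def linform_0[OF lin(1)] linform_add[OF lin(1)] linform_scale[OF lin(1)])
  define indep where "indep k e \<longleftrightarrow> (\<forall>c. (\<Sum>j<k. c j *s e j) \<in> rad \<longrightarrow> (\<forall>j<k. c j = 0))"
    for k :: nat and e :: "nat \<Rightarrow> complex ^ 'n"
  have "\<not> indep 4 e" for e
  proof
    assume ind: "indep 4 e"
    define h :: "4 \<Rightarrow> nat" where "h = (\<lambda>i. nat (Rep_bit0 i))"
    obtain h :: "4 \<Rightarrow> nat" where h: "bij_betw h UNIV {..<4}"
      using ex_bij_betw_finite_nat[of "UNIV :: 4 set"] by (auto simp: atLeast0LessThan)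
    obtain c :: "complex ^ 4" where c: "c \<noteq> 0" "\<And>y z. \<tau> (\<Sum>j\<in>UNIV. c $ j *s e (h j)) y z = 0"
      using four_vectors_closure[OF T, of "\<lambda>j. e (h j)"] unfolding \<tau>_def by blast
    define d where "d k = c $ (inv h k)" for k
    have d: "d (h j) = c $ j" for j
      using h by (simp add: d_def inv_f_f bij_betw_imp_inj_on)
    have "(\<Sum>k<4. d k *s e k) = (\<Sum>j\<in>UNIV. c $ j *s e (h j))"
      using sum.reindex_bij_betw[OF h, of "\<lambda>k. d k *s e k"] by (simp add: d)
    then have "\<forall>k<4. d k = 0" using ind c(2) unfolding indep_def rad_def by simp
    then have "c $ j = 0" for j using d[of j] h by (metis bij_betw_apply UNIV_I lessThan_iff)
    with c(1) show False by (simp add: vec_eq_iff)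
  qed
  moreover have "\<exists>e. indep 0 e" by (simp add: indep_def)
  ultimately obtain k where "k < 4" "\<exists>e. indep k e" and dep: "\<And>e. \<not> indep (Suc k) e"
    using ex_least_nat_less[of "\<lambda>k. \<not> (\<exists>e. indep k e)" 4] by auto
  then obtain e where e: "indep k e" by blast
  have "\<exists>d. x - (\<Sum>j<k. d j *s e j) \<in> rad" for x
  proof -
    obtain c where c: "(\<Sum>j<Suc k. c j *s (e(k := x)) j) \<in> rad" "\<exists>j<Suc k. c j \<noteq> 0"
      using dep[of "e(k := x)"] unfolding indep_def by blast
    then have c': "(\<Sum>j<k. c j *s e j) + c k *s x \<in> rad" by simp
    have "c k \<noteq> 0"
    proof
      assume "c k = 0"
      then have "\<forall>j<k. c j = 0" using e c' unfolding indep_def by simp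
      with c(2) \<open>c k = 0\<close> show False by (auto simp: less_Suc_eq)
    qed
    from vec.subspace_scale[OF rad c', of "1 / c k"]
    have "x - (\<Sum>j<k. (- c j / c k) *s e j) \<in> rad"
      using \<open>c k \<noteq> 0\<close> by (simp add: vec.scale_right_distrib vec.scale_sum_right sum_negf add.commute)
    then show ?thesis by (rule exI[of _ "\<lambda>j. - c j / c k"])
  qed
  then have "\<exists>d. \<forall>x. x - (\<Sum>j<k. d x j *s e j) \<in> rad" by (intro choice allI)
  then obtain d where d: "\<And>x. x - (\<Sum>j<k. d x j *s e j) \<in> rad" by blast
  \<comment> \<open>The coordinates \<open>d\<close> come from a choice; their uniqueness makes them
    linear in \<open>x\<close>.\<close>
  have unique: "\<forall>j<k. c j = d x j" if "x - (\<Sum>j<k. c j *s e j) \<in> rad" for c x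
  proof -
    have "(\<Sum>j<k. (c j - d x j) *s e j) \<in> rad"
      using vec.subspace_diff[OF rad d[of x] that] by (simp add: vec.scale_left_diff_distrib sum_subtractf)
    from e[unfolded indep_def, rule_format, OF this] show ?thesis by simp
  qed
  have d_add: "d (x + y) j = d x j + d y j" if "j < k" for x y j
  proof -
    have "x + y - (\<Sum>j<k. (d x j + d y j) *s e j) \<in> rad"
      using vec.subspace_add[OF rad d[of x] d[of y]]
      by (simp add: vec.scale_left_distrib sum.distrib algebra_simps)
    from unique[OF this] that show ?thesis by simp
  qed
  have d_scale: "d (c *s x) j = c * d x j" if "j < k" for c x j
  proof -
    have "c *s x - (\<Sum>j<k. (c * d x j) *s e j) \<in> rad"
      using vec.subspace_scale[OF rad d[of x], of c]
      by (simp add: vec.scale_right_diff_distrib vec.scale_sum_right)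
    from unique[OF this] that show ?thesis by simp
  qed
  \<comment> \<open>Padding with zeros up to three lets systems of fewer than three vectors use the
    same ternary result.\<close>
  define E where "E j = (if j < k then e j else 0)" for j
  define D where "D x j = (if j < k then d x j else 0)" for x j
  define g :: "complex ^ 'n \<Rightarrow> complex ^ 3" where "g x = vector [D x 0, D x 1, D x 2]" for x
  define h :: "complex ^ 3 \<Rightarrow> complex ^ 'n" where "h s = s $ 1 *s E 0 + s $ 2 *s E 1 + s $ 3 *s E 2" for s
  have "linmap g"
    by (simp add: linmap_def g_def D_def vec_eq_iff forall_3 d_add d_scale)
  have "linmap h"
    by (simp add: linmap_def h_def vec_eq_iff algebra_simps)
  have "h (g x) = (\<Sum>j<k. d x j *s e j)" for x
  proof -
    have "(\<Sum>j<k. d x j *s e j) = (\<Sum>j<3. D x j *s E j)"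
      using \<open>k < 4\<close> by (intro sum.mono_neutral_cong_left) (auto simp: D_def E_def)
    also have "\<dots> = h (g x)"
      by (simp add: h_def g_def numeral_3_eq_3 lessThan_Suc) (simp add: numeral_2_eq_2 add.commute add.left_commute)
    finally show ?thesis by simp
  qed
  then have hg: "x - h (g x) \<in> rad" for x using d by simp
  have hg1: "\<tau> x y z = \<tau> (h (g x)) y z" for x y z
    using hg[of x] by (simp add: rad_def linform_diff[OF lin(1)])
  \<comment> \<open>The replacement is available in the first argument; symmetry brings each
    argument there in turn.\<close>
  have hg3: "\<tau> x y z = \<tau> (h (g x)) (h (g y)) (h (g z))" for x y z
  proof -
    have "\<tau> x y z = \<tau> y (h (g x)) z"
      unfolding hg1[of x] by (rule symmetric_trilinear_swap(1)[OF sym])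
    also have "\<dots> = \<tau> z (h (g y)) (h (g x))"
      unfolding hg1[of y] by (rule symmetric_trilinear_swap(5)[OF sym])
    also have "\<dots> = \<tau> (h (g x)) (h (g y)) (h (g z))"
      unfolding hg1[of z] by (rule symmetric_trilinear_swap(3)[OF sym])
    finally show ?thesis .
  qed
  define \<sigma> where "\<sigma> = (\<lambda>x y z. \<tau> (h x) (h y) (h z))"
  have "symmetric_trilinear \<sigma>"
    unfolding symmetric_trilinear_def
  proof (intro conjI allI)
    show "linform (\<lambda>x. \<sigma> x y z)" for y z
      unfolding \<sigma>_def using linform_comp[OF lin(1) \<open>linmap h\<close>] .
    show "\<sigma> x y z = \<sigma> y x z" "\<sigma> x y z = \<sigma> x z y" for x y z
      unfolding \<sigma>_def by (rule symmetric_trilinear_swap[OF sym])+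
  qed
  moreover have "aronhold \<sigma> a b c = 0" for a b c
    using aronhold_closure[OF T, of "h a" "h b" "h c"] unfolding aronhold_def \<sigma>_def \<tau>_def .
  ultimately have "comon \<sigma>" by (rule comon_ternary)
  have "comon \<tau>"
  proof (rule comon_pullback[OF \<open>linmap g\<close> \<open>linmap h\<close> \<open>comon \<sigma>\<close> _ \<sigma>_def])
    show "\<tau> = (\<lambda>x y z. \<sigma> (g x) (g y) (g z))"
      unfolding \<sigma>_def by (intro ext) (rule hg3)
  qed
  then show ?thesis unfolding \<tau>_def .
qed

theorem corollary1p10:
  fixes T :: "complex ^ ('n::finite \<times> 'n \<times> 'n)"
  assumes "T \<in> secant3_cone veronese_cone"
  shows "symmetric_rank T = tensor_rank T"
proof (rule symmetric_rank_eq_tensor_rank)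
  show "comon (tform T)"
    using assms secant3_cone_subset_closure by (blast intro: comon_of_closure)
qed

end
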